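(* Let $n$ be a positive integer and let $k,m,a$ be complex numbers with $a\neq0$ such that all the functions below are defined. Then $$-\sum _{p=1}^n \left(i 3^p\right)^k e^{2 i 3^{-1+p} m} \left(\Phi \left(e^{2 i 3^p m},-k,\tfrac{1}{3}-\tfrac{1}{2} i 3^{-p} \log (a)\right)+e^{2 i 3^{-1+p} m}\, \Phi \left(e^{2 i 3^p m},-k,\tfrac{2}{3}-\tfrac{1}{2} i 3^{-p} \log (a)\right)\right)$$ $$= -i^k e^{2 i m}\, \Phi \left(e^{2 i m},-k,1-\tfrac{1}{2} i \log (a)\right)+\left(i 3^n\right)^k e^{2 i 3^n m}\, \Phi \left(e^{2 i 3^n m},-k,1-\tfrac{1}{2} i 3^{-n} \log (a)\right).$$
   Context: $\Phi(z,s,v)$ is the Hurwitz–Lerch zeta function: $\Phi(z,s,v)=\sum_{j=0}^{\infty}\frac{z^j}{(j+v)^s}$ for $v\notin\{0,-1,-2,\dots\}$ and $|z|<1$ (or $|z|=1$, $\operatorname{Re}s>1$), and by analytic continuation (principal branch, cut along $z\in[1,\infty)$) for other values; $\Phi(1,s,v)$ is the Hurwitz zeta function $\zeta(s,v)$. Logarithms and powers are principal values. *)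

theory Defs
  imports "HOL-Complex_Analysis.Complex_Analysis"
begin

text \<open>
  The value at points of \<open>S\<close> of the holomorphic function on \<open>S\<close> that agrees with \<open>f\<close> on \<open>U\<close>;
  see \<open>analytic_continuation_eq\<close> for uniqueness. Nothing is claimed if no such function exists,
  or at points outside \<open>S\<close>.
\<close>
definition analytic_continuation ::
  "(complex \<Rightarrow> complex) \<Rightarrow> complex set \<Rightarrow> complex set \<Rightarrow> complex \<Rightarrow> complex" where
  "analytic_continuation f U S = (SOME g. g holomorphic_on S \<and> (\<forall>z\<in>U. g z = f z))"

lemma analytic_continuation_eq:
  assumes "open S" "connected S" "open U" "U \<noteq> {}" "U \<subseteq> S"
    and g: "g holomorphic_on S" "\<And>z. z \<in> U \<Longrightarrow> g z = f z" and z: "z \<in> S"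
  shows "analytic_continuation f U S z = g z"
proof -
  define h where "h = analytic_continuation f U S"
  have h: "h holomorphic_on S \<and> (\<forall>z\<in>U. h z = f z)"
    unfolding h_def analytic_continuation_def by (rule someI[of _ g]) (use g in auto)
  have "h z = g z"
  proof (rule analytic_continuation_open[of U S h g])
    show "h w = g w" if "w \<in> U" for w using that h g by simp
  qed (use assms h in auto)
  thus ?thesis by (simp add: h_def)
qed

definition lerch_series :: "complex \<Rightarrow> complex \<Rightarrow> complex \<Rightarrow> complex" where
  "lerch_series z s v = (\<Sum>j. z ^ j / (of_nat j + v) powr s)"

definition hurwitz_zeta :: "complex \<Rightarrow> complex \<Rightarrow> complex" where
  "hurwitz_zeta s v =
     analytic_continuation (\<lambda>s. lerch_series 1 s v) {s. Re s > 1} (- {1}) s"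

definition lerch_cut :: "complex set" where
  "lerch_cut = complex_of_real ` {1..}"

definition lerch_phi :: "complex \<Rightarrow> complex \<Rightarrow> complex \<Rightarrow> complex" where
  "lerch_phi z s v =
     (if norm z < 1 \<or> norm z = 1 \<and> Re s > 1 then lerch_series z s v
      else if z = 1 then hurwitz_zeta s v
      else analytic_continuation (\<lambda>z. lerch_series z s v) (ball 0 1) (- lerch_cut) z)"

text \<open>
  The domain of \<open>\<Phi>\<close>. On the cut only the branch point \<open>z = 1\<close> is admitted, where \<open>\<Phi>\<close> is the
  Hurwitz zeta function, with its pole at \<open>s = 1\<close> excluded.
\<close>
definition lerch_phi_defined :: "complex \<Rightarrow> complex \<Rightarrow> complex \<Rightarrow> bool" where
  "lerch_phi_defined z s v \<longleftrightarrow>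
     v \<notin> \<int>\<^sub>\<le>\<^sub>0 \<and> (z \<notin> lerch_cut \<or> z = 1 \<and> s \<noteq> 1)"

end

theory Submission
  imports Defs
begin

text \<open>
  Write \<open>\<Phi>(z, s, v)\<close> for the Lerch function and put \<open>z\<^sub>p = exp (2
  \<i> 3^p m)\<close> and \<open>v\<^sub>p = 1 - \<i>/2 Ln a / 3^p\<close>. Sorting the terms
  \<open>z^j / (j + v)^s\<close> of the series by the residue of \<open>j\<close> modulo 3 gives
  the trisection formula \<open>\<Phi>(z, s, v) = 3^(-s) (\<Phi>(z^3, s, v/3) + z \<Phi>(z^3, s,
  (v+1)/3) + z^2 \<Phi>(z^3, s, (v+2)/3))\<close>. Since \<open>z\<^sub>p = z\<^sub>q^3\<close>
  and \<open>(v\<^sub>q + 2)/3 = v\<^sub>p\<close> for \<open>q = p - 1\<close>, this formula at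
  \<open>z\<^sub>q\<close> and \<open>v\<^sub>q\<close> says that the \<open>p\<close>-th
  summand of the theorem is \<open>T\<^sub>q - T\<^sub>p\<close> with \<open>T\<^sub>p = (\<i>
  3^p)^k z\<^sub>p \<Phi>(z\<^sub>p, -k, v\<^sub>p)\<close>, and the sum telescopes.

  The series proves the trisection formula only where it converges; elsewhere the formula has to
  be continued analytically, in one of two ways.

  If \<open>z^3\<close> is off the cut, both sides are holomorphic in \<open>z\<close> on the
  set of all such \<open>z\<close>, which is the plane minus three rays and is star-shaped about
  0, so agreement on the unit disc suffices (\<open>lerch_phi_trisection_off_cut\<close>).

  If \<open>z^3 = 1\<close>, the right-hand side consists of Hurwitz zeta values, and
  \<open>z\<close> may be a primitive cube root of unity, where \<open>\<Phi>\<close> is defined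
  by continuation in \<open>z\<close>. Here the variable of continuation has to be
  \<open>s\<close>, starting from \<open>Re s > 1\<close>
  (\<open>lerch_phi_trisection_at_cube_roots\<close>). This needs that at a fixed
  \<open>z\<close> off the cut the function obtained by continuation in \<open>z\<close> is
  entire in \<open>s\<close>.

  Both continuations are constructed for \<open>Re v > 0\<close>, and then for every
  \<open>v\<close> by splitting off finitely many terms of the series. For \<open>z\<close> off
  the cut, \<open>\<Phi>(z, s, v) = 1/\<Gamma>(s+N) \<integral> t^(s+N-1) exp (-v t) E\<^sub>N(z
  exp (-t)) dt\<close> over \<open>(0, \<infinity>)\<close>, where \<open>E\<^sub>N(u)\<close>
  is the rational function \<open>\<Sum>j. (j+v)^N u^j\<close>; the integral makes sense for
  \<open>Re s > -N\<close> and is holomorphic in \<open>z\<close> and in \<open>s\<close>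
  (\<open>entire_lerch_extension_exists\<close>). At \<open>z = 1\<close>, the function
  \<open>Z(s, v) = (s-1) \<zeta>(s, v)\<close> satisfies \<open>Z(s, v) = v^(1-s) + (s-1)
  \<integral> (1-y) Z(s+1, v+y) dy\<close> over \<open>[0, 1]\<close>, which extends it to the
  left one unit at a time (\<open>hurwitz_extension_step\<close>).
\<close>

section \<open>Holomorphic dependence of integrals on a parameter\<close>

text \<open>
  By the Cauchy inequality, the local bound \<open>h\<close> on \<open>f\<close> bounds the
  difference quotients near \<open>x\<close> by \<open>2 h / e\<close>, so dominated convergence
  applies to them along every sequence tending to \<open>x\<close>.
\<close>
lemma holomorphic_on_lebesgue_integral:
  fixes f :: "complex \<Rightarrow> 'a \<Rightarrow> complex"
  assumes "open U"
    and meas: "\<And>x. x \<in> U \<Longrightarrow> f x \<in> borel_measurable M"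
    and hol: "\<And>t. t \<in> space M \<Longrightarrow> (\<lambda>x. f x t) holomorphic_on U"
    and dom: "\<And>x. x \<in> U \<Longrightarrow> \<exists>e>0. \<exists>h. cball x e \<subseteq> U \<and> integrable M h \<and>
                (\<forall>y\<in>cball x e. \<forall>t\<in>space M. norm (f y t) \<le> h t)"
  shows "(\<lambda>x. \<integral>t. f x t \<partial>M) holomorphic_on U"
proof -
  define F where "F = (\<lambda>x. \<integral>t. f x t \<partial>M)"
  have "\<exists>d. (F has_field_derivative d) (at x)" if x: "x \<in> U" for x
  proof -
    obtain e h where e: "e > 0" "cball x e \<subseteq> U" and h: "integrable M h"
      and fh: "\<And>y t. y \<in> cball x e \<Longrightarrow> t \<in> space M \<Longrightarrow> norm (f y t) \<le> h t"
      using dom[OF x] by blast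
    have int: "integrable M (f y)" if "y \<in> cball x e" for y
    proof (rule Bochner_Integration.integrable_bound[OF h])
      show "f y \<in> borel_measurable M" using meas e that by blast
      show "AE t in M. norm (f y t) \<le> norm (h t)"
        using fh[OF that] by (intro AE_I2) (metis abs_ge_self order_trans real_norm_def)
    qed
    have der: "((\<lambda>x. f x t) has_field_derivative deriv (\<lambda>x. f x t) y) (at y)"
      if "y \<in> U" "t \<in> space M" for y t
      using holomorphic_derivI[OF hol \<open>open U\<close>] that by blast
    have lip: "norm (f y t - f x t) \<le> 2 * h t / e * norm (y - x)"
      if y: "y \<in> ball x (e/2)" and t: "t \<in> space M" for y t
    proof (rule field_differentiable_bound[of "ball x (e/2)" "\<lambda>x. f x t" "deriv (\<lambda>x. f x t)"])
      fix z assume z: "z \<in> ball x (e/2)"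
      have sub: "cball z (e/2) \<subseteq> cball x e"
      proof
        fix w assume "w \<in> cball z (e/2)"
        thus "w \<in> cball x e" using z dist_triangle[of x w z] by simp
      qed
      have "z \<in> cball z (e/2)" using e by simp
      hence zU: "z \<in> U" using sub e(2) by blast
      have h1: "(\<lambda>x. f x t) holomorphic_on cball z (e/2)"
        using hol[OF t] holomorphic_on_subset sub e by blast
      have "norm ((deriv ^^ 1) (\<lambda>x. f x t) z) \<le> fact 1 * h t / (e/2)^1"
      proof (rule Cauchy_inequality)
        show "(\<lambda>x. f x t) holomorphic_on ball z (e/2)"
          using h1 holomorphic_on_subset ball_subset_cball by blast
        show "continuous_on (cball z (e/2)) (\<lambda>x. f x t)"
          using h1 holomorphic_on_imp_continuous_on by blast
        show "norm (f w t) \<le> h t" if "norm (z - w) = e/2" for w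
          using sub that t by (intro fh) (auto simp: dist_norm)
      qed (use e in auto)
      thus "norm (deriv (\<lambda>x. f x t) z) \<le> 2 * h t / e" by (simp add: field_simps)
      show "((\<lambda>x. f x t) has_field_derivative deriv (\<lambda>x. f x t) z) (at z within ball x (e/2))"
        using der[OF zU t] has_field_derivative_at_within by blast
    qed (use y e in auto)
    define g where "g = (\<lambda>t. deriv (\<lambda>x. f x t) x)"
    have "((\<lambda>y. (F y - F x) / (y - x)) \<longlongrightarrow> (\<integral>t. g t \<partial>M)) (at x)"
      unfolding tendsto_at_iff_sequentially
    proof (intro allI impI)
      fix X :: "nat \<Rightarrow> complex" assume X: "\<forall>i. X i \<in> UNIV - {x}" "X \<longlonglongrightarrow> x"
      have "eventually (\<lambda>n. X n \<in> ball x (e/2)) sequentially"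
        using X(2) e by (intro topological_tendstoD) auto
      then obtain N where N: "\<And>n. n \<ge> N \<Longrightarrow> X n \<in> ball x (e/2)"
        unfolding eventually_sequentially by blast
      define Y where "Y = (\<lambda>n. X (n + N))"
      have Y: "Y n \<in> ball x (e/2)" "Y n \<noteq> x" "Y n \<in> cball x e" for n
        using N[of "n+N"] X(1) e by (auto simp: Y_def)
      have Yx: "Y \<longlonglongrightarrow> x" unfolding Y_def by (rule LIMSEQ_ignore_initial_segment[OF X(2)])
      define s where "s = (\<lambda>n t. (f (Y n) t - f x t) / (Y n - x))"
      have ss: "s n \<in> borel_measurable M" for n
      proof -
        have [measurable]: "f (Y n) \<in> borel_measurable M" "f x \<in> borel_measurable M"
          using meas[OF subsetD[OF e(2) Y(3)[of n]]] meas[OF x] by auto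
        show ?thesis unfolding s_def by measurable
      qed
      have lim: "(\<lambda>n. s n t) \<longlonglongrightarrow> g t" if "t \<in> space M" for t
        using der[OF x that] Yx Y
        unfolding has_field_derivative_iff g_def s_def tendsto_at_iff_sequentially comp_def by blast
      have "(\<lambda>n. \<integral>t. s n t \<partial>M) \<longlonglongrightarrow> (\<integral>t. g t \<partial>M)"
      proof (rule integral_dominated_convergence[where w = "\<lambda>t. 2 * h t / e"])
        show "g \<in> borel_measurable M"
          using borel_measurable_LIMSEQ_metric[OF ss lim] by blast
        show "integrable M (\<lambda>t. 2 * h t / e)" using h by simp
        show "AE t in M. (\<lambda>n. s n t) \<longlonglongrightarrow> g t" using lim by (intro AE_I2)
        show "AE t in M. norm (s n t) \<le> 2 * h t / e" for n
          using lip[OF Y(1)[of n]] Y[of n]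
          by (intro AE_I2) (simp add: s_def norm_divide pos_divide_le_eq)
      qed (rule ss)
      also have "(\<lambda>n. \<integral>t. s n t \<partial>M) = (\<lambda>n. (F (Y n) - F x) / (Y n - x))"
        using int[OF Y(3)] int[of x] e
        by (simp add: s_def F_def Bochner_Integration.integral_diff)
      finally show "((\<lambda>y. (F y - F x) / (y - x)) \<circ> X) \<longlonglongrightarrow> (\<integral>t. g t \<partial>M)"
        unfolding Y_def comp_def using LIMSEQ_offset by fast
    qed
    thus ?thesis unfolding has_field_derivative_iff by blast
  qed
  thus ?thesis unfolding F_def using \<open>open U\<close> holomorphic_on_open by blast
qed

section \<open>The Gamma integral with a complex scale\<close>

text \<open>
  A measure of its own, rather than a set integral over \<open>{0<..}\<close>, so that
  \<open>holomorphic_on_lebesgue_integral\<close> applies with bounds that are required for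
  positive \<open>t\<close> only.
\<close>
definition halfline :: "real measure" where
  "halfline = restrict_space lborel {0<..}"

lemma space_halfline [simp]: "space halfline = {0<..}"
  by (simp add: halfline_def space_restrict_space)

lemma measurable_halfline_continuous:
  fixes f :: "real \<Rightarrow> 'a :: topological_space"
  shows "continuous_on {0<..} f \<Longrightarrow> f \<in> borel_measurable halfline"
  using borel_measurable_continuous_on_restrict[of "{0<..}" f]
  by (simp add: halfline_def cong: measurable_cong_sets restrict_space_sets_cong)

lemma integrable_halfline_iff:
  fixes f :: "real \<Rightarrow> 'a :: {banach, second_countable_topology}"
  shows "integrable halfline f \<longleftrightarrow> set_integrable lborel {0<..} f"
  unfolding halfline_def set_integrable_def by (subst integrable_restrict_space) auto

lemma integral_halfline:
  fixes f :: "real \<Rightarrow> 'a :: {banach, second_countable_topology}"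
  shows "(\<integral>t. f t \<partial>halfline) = (LINT t:{0<..}|lborel. f t)"
  unfolding halfline_def set_lebesgue_integral_def by (subst integral_restrict_space) auto

lemma continuous_on_powr_halfline [continuous_intros]:
  "continuous_on {0<..} (\<lambda>t. complex_of_real t powr s)"
  by (intro continuous_intros) (auto simp: complex_nonpos_Reals_iff)

lemma norm_mellin_kernel:
  assumes "t > 0"
  shows "norm (complex_of_real t powr (s - 1) * exp (- (w * of_real t))) =
           t powr (Re s - 1) * exp (- (Re w * t))"
  using assms by (simp add: norm_mult norm_powr_real_powr)

text \<open>
  The modulus does not depend on \<open>Im w\<close>, so the Gamma integral with real scale
  \<open>Re w\<close> is a dominating function.
\<close>
lemma integrable_mellin_kernel:
  assumes "Re s > 0" "Re w > 0"
  shows "integrable halfline (\<lambda>t. complex_of_real t powr (s - 1) * exp (- (w * of_real t)))"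
proof -
  let ?g = "\<lambda>t. complex_of_real t powr (s - 1) / of_real (exp (Re w * t))"
  have meas: "f \<in> borel_measurable halfline \<Longrightarrow> set_borel_measurable lborel {0<..} f"
    for f :: "real \<Rightarrow> complex"
    unfolding halfline_def set_borel_measurable_def
    by (subst (asm) borel_measurable_restrict_space_iff) auto
  have m1: "?g \<in> borel_measurable halfline"
    by (intro measurable_halfline_continuous continuous_intros) auto
  have "?g absolutely_integrable_on {0<..}"
    using absolutely_integrable_Gamma_integral[OF assms] .
  hence "integrable lborel (\<lambda>t. indicator {0<..} t *\<^sub>R ?g t)"
    using meas[OF m1] unfolding set_integrable_def set_borel_measurable_def
    by (subst (asm) integrable_completion) auto
  hence "integrable halfline ?g" by (simp add: integrable_halfline_iff set_integrable_def)
  thus ?thesis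
  proof (rule Bochner_Integration.integrable_bound)
    show "(\<lambda>t. complex_of_real t powr (s - 1) * exp (- (w * of_real t))) \<in> borel_measurable halfline"
      by (intro measurable_halfline_continuous continuous_intros)
    show "AE t in halfline. norm (complex_of_real t powr (s - 1) * exp (- (w * of_real t))) \<le> norm (?g t)"
    proof (intro AE_I2)
      fix t assume "t \<in> space halfline"
      hence t: "t > 0" by simp
      show "norm (complex_of_real t powr (s - 1) * exp (- (w * of_real t))) \<le> norm (?g t)"
      proof -
        have "norm (?g t) = t powr (Re s - 1) / exp (Re w * t)"
          using t by (simp add: norm_divide norm_powr_real_powr)
        thus ?thesis unfolding norm_mellin_kernel[OF t] by (simp add: exp_minus divide_inverse)
      qed
    qed
  qed
qed

lemma integrable_real_mellin_kernel:
  assumes "a > 0" "c > 0"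
  shows "integrable halfline (\<lambda>t. t powr (a - 1) * exp (- (c * t)))"
proof -
  have "integrable halfline (\<lambda>t. norm (complex_of_real t powr (of_real a - 1) * exp (- (of_real c * of_real t))))"
    using assms by (intro integrable_norm integrable_mellin_kernel) auto
  also have "?this \<longleftrightarrow> ?thesis"
    by (intro Bochner_Integration.integrable_cong) (auto simp: norm_mellin_kernel)
  finally show ?thesis .
qed

lemma mellin_kernel_integral_holomorphic:
  assumes "Re s > 0"
  shows "(\<lambda>w. \<integral>t. of_real t powr (s - 1) * exp (- (w * of_real t)) \<partial>halfline)
           holomorphic_on {w. Re w > 0}"
proof (rule holomorphic_on_lebesgue_integral)
  show "open {w::complex. Re w > 0}" by (rule open_halfspace_Re_gt)
  show "(\<lambda>t. complex_of_real t powr (s - 1) * exp (- (w * of_real t))) \<in> borel_measurable halfline" for w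
    by (intro measurable_halfline_continuous continuous_intros)
  show "(\<lambda>w. complex_of_real t powr (s - 1) * exp (- (w * of_real t))) holomorphic_on {w. 0 < Re w}" for t
    by (intro holomorphic_intros)
  fix w :: complex assume w: "w \<in> {w. Re w > 0}"
  define c where "c = Re w / 2"
  have c: "c > 0" using w by (simp add: c_def)
  have le: "Re y \<ge> c" if "y \<in> cball w c" for y
    using that abs_Re_le_cmod[of "w - y"] by (simp add: dist_norm c_def abs_le_iff field_simps)
  show "\<exists>e>0. \<exists>h. cball w e \<subseteq> {w. 0 < Re w} \<and> integrable halfline h \<and>
          (\<forall>y\<in>cball w e. \<forall>t\<in>space halfline.
              cmod (complex_of_real t powr (s - 1) * exp (- (y * complex_of_real t))) \<le> h t)"
  proof (intro exI[of _ c] exI[of _ "\<lambda>t. t powr (Re s - 1) * exp (- (c * t))"] conjI ballI)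
    show "integrable halfline (\<lambda>t. t powr (Re s - 1) * exp (- (c * t)))"
      using assms c by (rule integrable_real_mellin_kernel)
    show "cball w c \<subseteq> {w. 0 < Re w}"
    proof
      fix y assume "y \<in> cball w c" thus "y \<in> {w. 0 < Re w}" using le[of y] c by simp
    qed
    fix y t assume "y \<in> cball w c" "t \<in> space halfline"
    thus "cmod (complex_of_real t powr (s - 1) * exp (- (y * complex_of_real t)))
           \<le> t powr (Re s - 1) * exp (- (c * t))"
      using le[of y] by (simp add: norm_mellin_kernel mult_left_mono mult_right_mono)
  qed (use c in auto)
qed

text \<open>
  For real \<open>w\<close> this is a linear substitution in Euler's integral. Both sides are
  holomorphic in \<open>w\<close> on the right half-plane, so the identity theorem gives the
  complex case.
\<close>
lemma mellin_kernel_integral: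
  assumes s: "Re s > 0" and w: "Re w > 0"
  shows "(\<integral>t. of_real t powr (s - 1) * exp (- (w * of_real t)) \<partial>halfline) = Gamma s * w powr (-s)"
proof -
  define J where "J = (\<lambda>w. \<integral>t. of_real t powr (s - 1) * exp (- (w * of_real t)) \<partial>halfline)"
  have J1: "J 1 = Gamma s"
  proof -
    have int: "set_integrable lborel {0<..} (\<lambda>t. complex_of_real t powr (s - 1) * exp (- (1 * of_real t)))"
      using integrable_mellin_kernel[OF s, of 1] by (simp add: integrable_halfline_iff)
    have "J 1 = integral {0<..} (\<lambda>t. complex_of_real t powr (s - 1) * exp (- (1 * of_real t)))"
      unfolding J_def integral_halfline using set_borel_integral_eq_integral(2)[OF int] by simp
    also have "\<dots> = integral {0<..} (\<lambda>t. of_real t powr (s - 1) / of_real (exp t))"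
      by (rule integral_cong) (simp add: exp_minus divide_inverse exp_of_real)
    also have "\<dots> = Gamma s" using Gamma_integral_complex'[OF s] by (rule integral_unique)
    finally show ?thesis .
  qed
  have Jreal: "J (of_real c) = Gamma s * of_real c powr (-s)" if c: "c > 0" for c :: real
  proof -
    have "J 1 = (\<integral>t. indicator {0<..} t *\<^sub>R (of_real t powr (s - 1) * exp (- (1 * of_real t))) \<partial>lborel)"
      by (simp add: J_def integral_halfline set_lebesgue_integral_def)
    also have "\<dots> = \<bar>c\<bar> *\<^sub>R (\<integral>t. indicator {0<..} (0 + c * t) *\<^sub>R
                 (of_real (0 + c * t) powr (s - 1) * exp (- (1 * of_real (0 + c * t)))) \<partial>lborel)"
      using c by (intro lborel_integral_real_affine) auto
    also have "(\<integral>t. indicator {0<..} (0 + c * t) *\<^sub>R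
                 (of_real (0 + c * t) powr (s - 1) * exp (- (1 * of_real (0 + c * t)))) \<partial>lborel) =
               (\<integral>t. of_real c powr (s - 1) * (indicator {0<..} t *\<^sub>R
                 (of_real t powr (s - 1) * exp (- (of_real c * of_real t)))) \<partial>lborel)"
      using c by (intro Bochner_Integration.integral_cong)
                 (auto simp: indicator_def zero_less_mult_iff powr_times_real)
    also have "\<dots> = of_real c powr (s - 1) * J (of_real c)"
      unfolding J_def integral_halfline set_lebesgue_integral_def
      by (subst integral_mult_right_zero[symmetric], intro Bochner_Integration.integral_cong) auto
    finally have "Gamma s = of_real c * (of_real c powr (s - 1) * J (of_real c))"
      using c J1 by (simp add: scaleR_conv_of_real)
    also have "\<dots> = of_real c powr s * J (of_real c)"
      using c by (simp add: powr_diff)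
    finally show ?thesis using c by (simp add: powr_minus field_simps)
  qed
  have "J w - Gamma s * w powr (-s) = 0"
  proof (rule analytic_continuation[where f = "\<lambda>w. J w - Gamma s * w powr (-s)"
          and S = "{w. Re w > 0}" and U = "complex_of_real ` {0<..}" and \<xi> = 1])
    show "(\<lambda>w. J w - Gamma s * w powr (-s)) holomorphic_on {w. Re w > 0}"
      unfolding J_def
      by (intro holomorphic_intros mellin_kernel_integral_holomorphic s) (auto simp: complex_nonpos_Reals_iff)
    show "connected {w::complex. Re w > 0}"
      by (intro convex_connected convex_halfspace_Re_gt)
    show "1 islimpt complex_of_real ` {0<..}"
      unfolding islimpt_approachable
    proof (intro allI impI)
      fix e :: real assume "e > 0"
      moreover from this have "complex_of_real (1 + e/2) - 1 = of_real (e/2)"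
        "complex_of_real (1 + e/2) \<noteq> 1"
        by (simp_all add: complex_eq_iff)
      ultimately show "\<exists>x'\<in>complex_of_real ` {0<..}. x' \<noteq> 1 \<and> dist x' 1 < e"
        unfolding dist_norm
        by (intro bexI[of _ "complex_of_real (1 + e/2)"] conjI imageI) (simp_all only: norm_of_real, auto)
    qed
  qed (use Jreal w in \<open>auto simp: open_halfspace_Re_gt\<close>)
  thus ?thesis by (simp add: J_def)
qed

section \<open>The cut plane\<close>

lemma lerch_cut_iff: "z \<in> lerch_cut \<longleftrightarrow> Im z = 0 \<and> Re z \<ge> 1"
  by (auto simp: lerch_cut_def complex_eq_iff intro!: image_eqI[of _ _ "Re z"])

lemma closed_lerch_cut: "closed lerch_cut"
proof -
  have "lerch_cut = {z. Im z = 0} \<inter> {z. Re z \<ge> 1}" by (auto simp: lerch_cut_iff)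
  moreover have "closed {z. Im z = 0}" "closed {z. Re z \<ge> 1}"
    using closed_halfspace_Im_eq closed_halfspace_Re_ge by auto
  ultimately show ?thesis by (metis closed_Int)
qed

lemma open_Compl_lerch_cut: "open (- lerch_cut)"
  using closed_lerch_cut by blast

lemma ball_subset_Compl_lerch_cut: "ball 0 1 \<subseteq> - lerch_cut"
proof
  fix z :: complex assume "z \<in> ball 0 1"
  thus "z \<in> - lerch_cut" using complex_Re_le_cmod[of z] by (auto simp: lerch_cut_iff)
qed

text \<open>
  The cut plane is star-shaped about 0: this makes it connected, and it keeps the argument of
  the kernel in the Mellin integral off the cut.
\<close>
lemma scale_notin_lerch_cut:
  assumes "z \<notin> lerch_cut" "0 \<le> r" "r \<le> 1"
  shows "of_real r * z \<notin> lerch_cut"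
proof
  assume "of_real r * z \<in> lerch_cut"
  hence *: "r * Im z = 0" "r * Re z \<ge> 1" by (auto simp: lerch_cut_iff)
  hence "r \<noteq> 0" by auto
  with assms(2) have "r > 0" by simp
  moreover have "0 < r * Re z" using * by simp
  ultimately have "Re z \<ge> 0" "Im z = 0" using * by (auto simp: zero_less_mult_iff)
  moreover have "r * Re z \<le> Re z" using assms \<open>Re z \<ge> 0\<close> by (simp add: mult_left_le_one_le)
  ultimately have "z \<in> lerch_cut" using * by (auto simp: lerch_cut_iff)
  with assms show False by simp
qed

lemma connected_Compl_lerch_cut: "connected (- lerch_cut)"
proof (rule starlike_imp_connected)
  have "closed_segment 0 z \<subseteq> - lerch_cut" if "z \<in> - lerch_cut" for z
  proof
    fix x assume "x \<in> closed_segment 0 z"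
    then obtain r where "0 \<le> r" "r \<le> 1" "x = of_real r * z"
      by (auto simp: in_segment scaleR_conv_of_real)
    thus "x \<in> - lerch_cut" using scale_notin_lerch_cut[of z r] that by simp
  qed
  thus "starlike (- lerch_cut)"
    unfolding starlike_def by (intro bexI[of _ 0]) (auto simp: lerch_cut_iff)
qed

section \<open>Mellin integrals of functions on the cut plane\<close>

text \<open>
  The closed form of \<open>\<Sum>j. (j + v)^N u^j\<close>, obtained from the geometric series
  by applying the operator \<open>v + u d/du\<close> \<open>N\<close> times, and therefore
  available on the whole cut plane.
\<close>
primrec lerch_kernel :: "complex \<Rightarrow> nat \<Rightarrow> complex \<Rightarrow> complex" where
  "lerch_kernel v 0 = (\<lambda>u. 1 / (1 - u))"
| "lerch_kernel v (Suc N) = (\<lambda>u. v * lerch_kernel v N u + u * deriv (lerch_kernel v N) u)"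

lemma holomorphic_lerch_kernel: "lerch_kernel v N holomorphic_on - lerch_cut"
proof (induction N)
  case 0
  have "1 - u \<noteq> 0" if "u \<in> - lerch_cut" for u
    using that by (auto simp: lerch_cut_iff)
  thus ?case by (auto intro!: holomorphic_intros)
next
  case (Suc N)
  thus ?case
    unfolding lerch_kernel.simps
    by (intro holomorphic_on_add holomorphic_on_mult holomorphic_on_const holomorphic_on_ident
          holomorphic_deriv open_Compl_lerch_cut)
qed

lemma lerch_kernel_sums:
  assumes "norm u < 1"
  shows "(\<lambda>j. (of_nat j + v) ^ N * u ^ j) sums lerch_kernel v N u"
  using assms
proof (induction N arbitrary: u)
  case 0
  thus ?case using geometric_sums[of u] by simp
next
  case (Suc N)
  define c where "c = (\<lambda>j. (of_nat j + v) ^ N)"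
  have "u \<in> - lerch_cut" using Suc.prems ball_subset_Compl_lerch_cut by auto
  hence "(lerch_kernel v N has_field_derivative deriv (lerch_kernel v N) u) (at u)"
    using holomorphic_derivI[OF holomorphic_lerch_kernel open_Compl_lerch_cut] by blast
  hence "(\<lambda>n. diffs c n * u ^ n) sums deriv (lerch_kernel v N) u"
    using Suc unfolding c_def by (intro termdiffs_sums_strong[of 1]) auto
  hence "(\<lambda>n. u * (diffs c n * u ^ n)) sums (u * deriv (lerch_kernel v N) u)"
    by (rule sums_mult)
  hence "(\<lambda>n. of_nat (Suc n) * c (Suc n) * u ^ Suc n) sums (u * deriv (lerch_kernel v N) u)"
    by (simp add: diffs_def mult_ac)
  hence "(\<lambda>n. of_nat n * c n * u ^ n) sums (u * deriv (lerch_kernel v N) u)"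
    using sums_Suc_iff[of "\<lambda>n. of_nat n * c n * u ^ n"] by simp
  from sums_add[OF sums_mult[OF Suc.IH[OF Suc.prems], of v] this] show ?case
    by (simp add: c_def algebra_simps)
qed

text \<open>
  If \<open>E(u) = \<Sum>j. c\<^sub>j u^j\<close>, this is \<open>\<Sum>j. c\<^sub>j z^j
  (j+v)^(-s)\<close>. Only values of \<open>E\<close> on the segment from 0 to \<open>z\<close>
  enter, so the integral inherits from \<open>E\<close> the continuation to the cut plane.
\<close>
definition lerch_integral :: "(complex \<Rightarrow> complex) \<Rightarrow> complex \<Rightarrow> complex \<Rightarrow> complex \<Rightarrow> complex" where
  "lerch_integral E z s v = rGamma s *
     (\<integral>t. of_real t powr (s - 1) * exp (- (v * of_real t)) * E (of_real (exp (-t)) * z) \<partial>halfline)"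

lemma ray_notin_lerch_cut:
  assumes "z \<notin> lerch_cut" "t > 0"
  shows "of_real (exp (-t)) * z \<notin> lerch_cut"
  using assms by (intro scale_notin_lerch_cut) auto

text \<open>
  The segments from 0 to the points of \<open>K\<close> fill out a compact subset of the cut
  plane. This bound supplies the dominating functions in both variables.
\<close>
lemma bounded_along_rays:
  fixes E :: "complex \<Rightarrow> complex"
  assumes "continuous_on (- lerch_cut) E" "compact K" "K \<subseteq> - lerch_cut"
  obtains C where "C \<ge> 0" "\<And>z t. z \<in> K \<Longrightarrow> t > 0 \<Longrightarrow> norm (E (of_real (exp (-t)) * z)) \<le> C"
proof -
  define S where "S = (\<lambda>(r, z). of_real r * z) ` ({0..1::real} \<times> K)"
  have "compact S" unfolding S_def
    using assms(2) by (intro compact_continuous_image compact_Times)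
      (auto simp: case_prod_beta intro!: continuous_intros)
  moreover have "S \<subseteq> - lerch_cut"
  proof
    fix x assume "x \<in> S"
    then obtain r z where "x = of_real r * z" "0 \<le> r" "r \<le> 1" "z \<in> K"
      by (auto simp: S_def)
    thus "x \<in> - lerch_cut"
      using assms(3) scale_notin_lerch_cut[of z r] by blast
  qed
  ultimately have "bounded (E ` S)"
    using assms(1) by (meson compact_continuous_image compact_imp_bounded continuous_on_subset)
  then obtain C where C: "\<And>x. x \<in> S \<Longrightarrow> norm (E x) \<le> C" unfolding bounded_iff by blast
  show ?thesis
  proof (rule that[of "max C 0"])
    fix z t assume "z \<in> K" "t > (0::real)"
    hence "of_real (exp (-t)) * z \<in> S"
      unfolding S_def by (intro image_eqI[of _ _ "(exp (-t), z)"]) auto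
    from C[OF this] show "norm (E (of_real (exp (-t)) * z)) \<le> max C 0" by simp
  qed auto
qed

lemma measurable_lerch_integrand:
  fixes E :: "complex \<Rightarrow> complex"
  assumes "continuous_on (- lerch_cut) E" "z \<notin> lerch_cut"
  shows "(\<lambda>t. of_real t powr (s - 1) * exp (- (v * of_real t)) * E (of_real (exp (-t)) * z))
           \<in> borel_measurable halfline"
proof (intro measurable_halfline_continuous continuous_on_mult continuous_on_powr_halfline
         continuous_on_compose2[OF assms(1)])
  show "(\<lambda>t. of_real (exp (- t)) * z) ` {0<..} \<subseteq> - lerch_cut"
    using ray_notin_lerch_cut[OF assms(2)] by auto
qed (intro continuous_intros)+

lemma norm_lerch_integrand:
  fixes E :: "complex \<Rightarrow> complex"
  assumes "t > 0" "norm (E (of_real (exp (-t)) * z)) \<le> C"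
  shows "norm (of_real t powr (s - 1) * exp (- (v * of_real t)) * E (of_real (exp (-t)) * z))
           \<le> C * (t powr (Re s - 1) * exp (- (Re v * t)))"
  unfolding norm_mult[of "_ * _"] norm_mellin_kernel[OF assms(1)]
  using assms by (subst mult.commute) (intro mult_right_mono, auto)

lemma lerch_integral_holomorphic_z:
  assumes E: "E holomorphic_on - lerch_cut" and "Re s > 0" "Re v > 0"
  shows "(\<lambda>z. lerch_integral E z s v) holomorphic_on - lerch_cut"
  unfolding lerch_integral_def
proof (intro holomorphic_on_mult holomorphic_on_const, rule holomorphic_on_lebesgue_integral)
  have cont: "continuous_on (- lerch_cut) E" using E by (rule holomorphic_on_imp_continuous_on)
  show "open (- lerch_cut)" by (rule open_Compl_lerch_cut)
  show "(\<lambda>t. of_real t powr (s - 1) * exp (- (v * of_real t)) * E (of_real (exp (-t)) * z))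
           \<in> borel_measurable halfline" if "z \<in> - lerch_cut" for z
    using that by (intro measurable_lerch_integrand cont) auto
  show "(\<lambda>z. of_real t powr (s - 1) * exp (- (v * of_real t)) * E (of_real (exp (-t)) * z))
           holomorphic_on - lerch_cut" if "t \<in> space halfline" for t
  proof (intro holomorphic_intros holomorphic_on_compose_gen[OF _ E, unfolded o_def])
    show "(\<lambda>z. of_real (exp (- t)) * z) ` (- lerch_cut) \<subseteq> - lerch_cut"
      using ray_notin_lerch_cut that by auto
  qed
  fix z assume z: "z \<in> - lerch_cut"
  obtain e where e: "e > 0" "cball z e \<subseteq> - lerch_cut"
    using open_Compl_lerch_cut z open_contains_cball by blast
  obtain C where C: "C \<ge> 0" "\<And>y t. y \<in> cball z e \<Longrightarrow> t > 0 \<Longrightarrow> norm (E (of_real (exp (-t)) * y)) \<le> C"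
    using bounded_along_rays[OF cont compact_cball e(2)] by metis
  have "integrable halfline (\<lambda>t. C * (t powr (Re s - 1) * exp (- (Re v * t))))"
    using assms by (intro integrable_mult_right integrable_real_mellin_kernel)
  moreover have "cmod (of_real t powr (s - 1) * exp (- (v * of_real t)) * E (of_real (exp (-t)) * y)) \<le>
      C * (t powr (Re s - 1) * exp (- (Re v * t)))" if "y \<in> cball z e" "t \<in> space halfline" for y t
    using C(2)[OF that(1)] that(2) by (intro norm_lerch_integrand) simp_all
  ultimately show "\<exists>e>0. \<exists>h. cball z e \<subseteq> - lerch_cut \<and> integrable halfline h \<and>
          (\<forall>y\<in>cball z e. \<forall>t\<in>space halfline.
              cmod (of_real t powr (s - 1) * exp (- (v * of_real t)) * E (of_real (exp (-t)) * y)) \<le> h t)"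
    by (intro exI[of _ e] exI[of _ "\<lambda>t. C * (t powr (Re s - 1) * exp (- (Re v * t)))"] conjI ballI e)
qed

text \<open>
  As \<open>s\<close> varies over a disc, the exponent of \<open>t\<close> stays between two
  values; the sum of the two extreme powers dominates near 0 as well as near infinity.
\<close>
lemma lerch_integral_holomorphic_s:
  assumes E: "E holomorphic_on - lerch_cut" and z: "z \<notin> lerch_cut" and v: "Re v > 0"
  shows "(\<lambda>s. lerch_integral E z s v) holomorphic_on {s. Re s > 0}"
  unfolding lerch_integral_def
proof (intro holomorphic_on_mult holomorphic_rGamma, rule holomorphic_on_lebesgue_integral)
  have cont: "continuous_on (- lerch_cut) E" using E by (rule holomorphic_on_imp_continuous_on)
  show "open {s::complex. 0 < Re s}" by (rule open_halfspace_Re_gt)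
  show "(\<lambda>t. of_real t powr (s - 1) * exp (- (v * of_real t)) * E (of_real (exp (-t)) * z))
           \<in> borel_measurable halfline" for s
    using z by (intro measurable_lerch_integrand cont) auto
  show "(\<lambda>s. of_real t powr (s - 1) * exp (- (v * of_real t)) * E (of_real (exp (-t)) * z))
           holomorphic_on {s. 0 < Re s}" if "t \<in> space halfline" for t
    using that by (intro holomorphic_on_mult holomorphic_on_const holomorphic_on_powr_right
                     holomorphic_on_diff holomorphic_on_ident)
  obtain C where C: "C \<ge> 0" "\<And>t. t > 0 \<Longrightarrow> norm (E (of_real (exp (-t)) * z)) \<le> C"
  proof -
    have "{z} \<subseteq> - lerch_cut" using z by simp
    from bounded_along_rays[OF cont _ this] show ?thesis
      using that by (metis finite.intros finite_imp_compact singletonI)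
  qed
  fix s :: complex assume "s \<in> {s. Re s > 0}"
  hence s: "Re s > 0" by simp
  define e where "e = Re s / 2"
  have e: "e > 0" using s by (simp add: e_def)
  have le: "Re y \<ge> e" "Re y \<le> 3 * e" if "y \<in> cball s e" for y
    using that abs_Re_le_cmod[of "s - y"] by (simp_all add: dist_norm e_def abs_le_iff field_simps)
  define h where "h = (\<lambda>t. C * (t powr (e - 1) * exp (- (Re v * t))) + C * (t powr (3 * e - 1) * exp (- (Re v * t))))"
  have "integrable halfline h"
    using assms e unfolding h_def
    by (intro Bochner_Integration.integrable_add integrable_mult_right integrable_real_mellin_kernel) auto
  moreover have "cball s e \<subseteq> {s. 0 < Re s}"
  proof
    fix y assume "y \<in> cball s e"
    thus "y \<in> {s. 0 < Re s}" using le(1)[of y] e by simp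
  qed
  moreover have "cmod (of_real t powr (y - 1) * exp (- (v * of_real t)) * E (of_real (exp (-t)) * z)) \<le> h t"
    if "y \<in> cball s e" "t \<in> space halfline" for y t
  proof -
    have t: "t > 0" using that by simp
    have "t powr (Re y - 1) \<le> t powr (e - 1) + t powr (3 * e - 1)"
    proof (cases "t \<ge> 1")
      case True
      thus ?thesis using le[OF that(1)] by (intro add_increasing powr_mono) auto
    next
      case False
      thus ?thesis using le[OF that(1)] t by (intro add_increasing2 powr_mono') auto
    qed
    hence "C * (t powr (Re y - 1) * exp (- (Re v * t))) \<le>
             C * ((t powr (e - 1) + t powr (3 * e - 1)) * exp (- (Re v * t)))"
      using C(1) by (intro mult_left_mono mult_right_mono) auto
    with norm_lerch_integrand[where E = E, OF t C(2)[OF t], of y v] show ?thesis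
      by (simp add: h_def algebra_simps)
  qed
  ultimately show "\<exists>e>0. \<exists>h. cball s e \<subseteq> {s. 0 < Re s} \<and> integrable halfline h \<and>
          (\<forall>y\<in>cball s e. \<forall>t\<in>space halfline.
              cmod (of_real t powr (y - 1) * exp (- (v * of_real t)) * E (of_real (exp (-t)) * z)) \<le> h t)"
    by (intro exI[of _ e] exI[of _ h] conjI ballI e)
qed

text \<open>
  Termwise integration; the interchange is justified by absolute convergence of the power series
  inside the unit disc.
\<close>
lemma lerch_integral_sums:
  assumes E: "\<And>u. norm u < 1 \<Longrightarrow> (\<lambda>j. c j * u ^ j) sums E u"
    and z: "norm z < 1" and s: "Re s > 0" and v: "Re v > 0"
  shows "(\<lambda>j. c j * z ^ j * (of_nat j + v) powr (-s)) sums lerch_integral E z s v"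
proof -
  define f where "f = (\<lambda>j t. c j * z ^ j * (of_real t powr (s - 1) * exp (- ((of_nat j + v) * of_real t))))"
  obtain x :: real where x: "norm z < x" "x < 1" using z dense by blast
  have "summable (\<lambda>j. c j * of_real x ^ j)"
    using E[of "of_real x"] x norm_ge_zero[of z] by (intro sums_summable) auto
  hence summ: "summable (\<lambda>j. norm (c j * z ^ j))"
    using x by (intro powser_insidea) auto
  have int: "integrable halfline (f j)" for j
    unfolding f_def using s v by (intro integrable_mult_right integrable_mellin_kernel) auto
  have intf: "(\<integral>t. f j t \<partial>halfline) = Gamma s * (c j * z ^ j * (of_nat j + v) powr (-s))" for j
    using mellin_kernel_integral[OF s, of "of_nat j + v"] v by (simp add: f_def)
  have f_eq: "f j t = of_real t powr (s - 1) * exp (- (v * of_real t)) *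
                (c j * (of_real (exp (-t)) * z) ^ j)" for j t
  proof -
    have "exp (- ((of_nat j + v) * of_real t)) = exp (- (v * of_real t)) * of_real (exp (-t)) ^ j"
    proof -
      have "of_real (exp (-t)) ^ j = exp (of_nat j * - complex_of_real t)"
        unfolding exp_of_nat_mult exp_of_real[symmetric] by simp
      hence "exp (- (v * of_real t)) * of_real (exp (-t)) ^ j =
               exp (- (v * of_real t) + of_nat j * - of_real t)"
        by (simp only: exp_add)
      thus ?thesis by (simp add: algebra_simps)
    qed
    thus ?thesis unfolding f_def power_mult_distrib by (simp only: mult_ac)
  qed
  have nrm: "norm (f j t) \<le> norm (c j * z ^ j) * (t powr (Re s - 1) * exp (- (Re v * t)))" if t: "t > 0" for j t
  proof -
    have "norm (f j t) = norm (c j * z ^ j) * (t powr (Re s - 1) * exp (- (Re (of_nat j + v) * t)))"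
      unfolding f_def norm_mult[of "c j * z ^ j"] norm_mellin_kernel[OF t] ..
    also have "\<dots> \<le> norm (c j * z ^ j) * (t powr (Re s - 1) * exp (- (Re v * t)))"
      using t by (intro mult_left_mono) auto
    finally show ?thesis .
  qed
  define G where "G = (\<integral>t. t powr (Re s - 1) * exp (- (Re v * t)) \<partial>halfline)"
  have "(\<lambda>j. \<integral>t. f j t \<partial>halfline) sums (\<integral>t. (\<Sum>j. f j t) \<partial>halfline)"
  proof (rule sums_integral[OF int])
    show "AE t in halfline. summable (\<lambda>j. norm (f j t))"
    proof (intro AE_I2)
      fix t assume "t \<in> space halfline"
      hence t: "t > 0" by simp
      show "summable (\<lambda>j. norm (f j t))"
        by (rule summable_comparison_test'[OF summable_mult2[OF summ]])
           (use nrm[OF t] in simp)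
    qed
    show "summable (\<lambda>j. \<integral>t. norm (f j t) \<partial>halfline)"
    proof (rule summable_comparison_test'[OF summable_mult2[OF summ, of G]])
      fix j :: nat
      have "(\<integral>t. norm (f j t) \<partial>halfline) \<le>
              (\<integral>t. norm (c j * z ^ j) * (t powr (Re s - 1) * exp (- (Re v * t))) \<partial>halfline)"
        using int nrm s v
        by (intro integral_mono integrable_norm integrable_mult_right integrable_real_mellin_kernel) auto
      thus "norm (\<integral>t. norm (f j t) \<partial>halfline) \<le> norm (c j * z ^ j) * G"
        by (simp add: G_def)
    qed
  qed
  also have "(\<integral>t. (\<Sum>j. f j t) \<partial>halfline) = (\<integral>t. of_real t powr (s - 1) * exp (- (v * of_real t)) * E (of_real (exp (-t)) * z) \<partial>halfline)"
  proof (intro Bochner_Integration.integral_cong)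
    fix t assume "t \<in> space halfline"
    hence t: "t > 0" by simp
    have "norm (of_real (exp (-t)) * z) \<le> 1 * norm z"
      unfolding norm_mult using t by (intro mult_right_mono) auto
    hence "norm (of_real (exp (-t)) * z) < 1" using z by simp
    from sums_mult[OF E[OF this]]
    show "(\<Sum>j. f j t) = of_real t powr (s - 1) * exp (- (v * of_real t)) * E (of_real (exp (-t)) * z)"
      unfolding f_eq by (rule sums_unique[symmetric])
  qed auto
  finally have "(\<lambda>j. rGamma s * (Gamma s * (c j * z ^ j * (of_nat j + v) powr (-s)))) sums lerch_integral E z s v"
    unfolding intf lerch_integral_def by (rule sums_mult)
  moreover have "rGamma s * Gamma s = 1"
  proof -
    have "s \<notin> \<int>\<^sub>\<le>\<^sub>0" using s by (auto elim!: nonpos_Ints_cases)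
    thus ?thesis by (simp add: rGamma_inverse_Gamma Gamma_eq_zero_iff)
  qed
  ultimately show ?thesis by (simp add: mult.assoc[symmetric])
qed

section \<open>The Lerch series on the closed disc\<close>

text \<open>
  The modulus of a complex power also involves the argument of the base, which contributes a
  factor of at most \<open>exp (pi |Im s|)\<close>. The bound is uniform in \<open>v\<close> and
  locally uniform in \<open>s\<close>.
\<close>
lemma norm_shifted_powr_le:
  fixes x \<sigma> T :: real
  assumes x: "x \<ge> 1" and v: "Re v \<ge> 0" and s: "0 \<le> \<sigma>" "\<sigma> \<le> Re s" "\<bar>Im s\<bar> \<le> T"
  shows "norm ((of_real x + v) powr (-s)) \<le> exp (pi * T) * x powr (-\<sigma>)"
proof -
  define w where "w = of_real x + v"
  have "x \<le> Re w" using v by (simp add: w_def)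
  hence w: "x \<le> norm w" using complex_Re_le_cmod[of w] by linarith
  have "norm w powr Re (-s) \<le> x powr (-\<sigma>)"
  proof -
    have "norm w powr Re (-s) \<le> x powr Re (-s)" using w x s by (intro powr_mono2') auto
    also have "\<dots> \<le> x powr (-\<sigma>)" using x s by (intro powr_mono) auto
    finally show ?thesis .
  qed
  moreover have "- Im (-s) * Arg w \<le> pi * T"
  proof -
    have "Im s * Arg w \<le> \<bar>Im s\<bar> * \<bar>Arg w\<bar>" by (metis abs_ge_self abs_mult)
    also have "\<dots> \<le> T * pi" using s Arg_bounded[of w] by (intro mult_mono) auto
    finally show ?thesis by (simp add: mult.commute)
  qed
  ultimately have "norm w powr Re (-s) * exp (- Im (-s) * Arg w) \<le> x powr (-\<sigma>) * exp (pi * T)"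
    by (intro mult_mono) auto
  thus ?thesis by (simp add: norm_powr_complex w_def mult.commute)
qed

lemma summable_hurwitz:
  assumes s: "Re s > 1"
  shows "summable (\<lambda>j. norm ((of_nat j + v) powr (-s)))"
proof -
  obtain N :: nat where N: "- Re v \<le> real N" using real_arch_simple by blast
  have "summable (\<lambda>j. norm ((of_nat (j + Suc N) + v) powr (-s)))"
  proof (rule summable_comparison_test')
    show "summable (\<lambda>j. exp (pi * \<bar>Im s\<bar>) * real (Suc j) powr (- Re s))"
      using s by (intro summable_mult) (subst summable_Suc_iff, simp add: summable_real_powr_iff)
    fix j :: nat
    have "norm ((of_real (real (Suc j)) + (of_nat N + v)) powr (-s)) \<le> exp (pi * \<bar>Im s\<bar>) * real (Suc j) powr (- Re s)"
      using s N by (intro norm_shifted_powr_le) auto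
    thus "norm (norm ((of_nat (j + Suc N) + v) powr (-s))) \<le> exp (pi * \<bar>Im s\<bar>) * real (Suc j) powr (- Re s)"
      by (simp add: add_ac)
  qed
  thus ?thesis by (subst (asm) summable_iff_shift)
qed

lemma lerch_term_eq: "z ^ j / (of_nat j + v) powr s = z ^ j * (of_nat j + v) powr (- s)"
  for z v s :: complex
  by (simp add: powr_minus divide_inverse)

lemma lerch_series_converges_unit:
  assumes "norm z \<le> 1" "Re s > 1"
  shows "(\<lambda>j. z ^ j / (of_nat j + v) powr s) sums lerch_series z s v"
proof -
  have "summable (\<lambda>j. z ^ j / (of_nat j + v) powr s)"
  proof (rule summable_comparison_test'[OF summable_hurwitz[OF assms(2)]])
    show "norm (z ^ j / (of_nat j + v) powr s) \<le> norm ((of_nat j + v) powr (-s))" for j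
      using assms(1) unfolding lerch_term_eq norm_mult norm_power
      by (intro mult_left_le_one_le power_le_one) auto
  qed
  thus ?thesis unfolding lerch_series_def by (rule summable_sums)
qed

text \<open>
  Links the series on the unit circle with the continuation from inside the disc.
\<close>
lemma continuous_on_lerch_series_unit:
  assumes "Re s > 1"
  shows "continuous_on (cball 0 1) (\<lambda>z. lerch_series z s v)"
proof -
  have "uniform_limit (cball 0 1) (\<lambda>n z. \<Sum>j<n. z ^ j / (of_nat j + v) powr s)
          (\<lambda>z. lerch_series z s v) sequentially"
    unfolding lerch_series_def
  proof (rule Weierstrass_m_test[OF _ summable_hurwitz[OF assms]])
    show "norm (z ^ j / (of_nat j + v) powr s) \<le> norm ((of_nat j + v) powr (-s))"
      if "z \<in> cball 0 1" for z j
      using that unfolding lerch_term_eq norm_mult norm_power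
      by (intro mult_left_le_one_le power_le_one) auto
  qed
  thus ?thesis
    by (rule uniform_limit_theorem[rotated])
       (auto intro!: always_eventually continuous_intros simp: divide_inverse)
qed

section \<open>The Lerch function off the cut\<close>

text \<open>
  One function of both variables that is holomorphic in each of them. Holomorphy in
  \<open>z\<close> identifies it with the analytic continuation in the definition of the Lerch
  function; holomorphy in \<open>s\<close> is what the comparison at \<open>z^3 = 1\<close>
  uses.
\<close>
definition entire_lerch_extension :: "(complex \<Rightarrow> complex \<Rightarrow> complex) \<Rightarrow> complex \<Rightarrow> bool" where
  "entire_lerch_extension F v \<longleftrightarrow>
     (\<forall>s. (\<lambda>z. F z s) holomorphic_on - lerch_cut) \<and>
     (\<forall>z. z \<notin> lerch_cut \<longrightarrow> F z holomorphic_on UNIV) \<and>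
     (\<forall>z s. norm z < 1 \<longrightarrow> (\<lambda>j. z ^ j / (of_nat j + v) powr s) sums F z s)"

text \<open>
  Writing \<open>(j+v)^(-s) = (j+v)^N (j+v)^(-(s+N))\<close> and summing the first factor into
  the kernel of order \<open>N\<close> gives a Mellin integral that converges for \<open>Re s >
  -N\<close>. Functions with different \<open>N\<close> have the same series in the unit disc,
  so they agree on the cut plane wherever both are defined, and together they cover all
  \<open>s\<close>.
\<close>
lemma entire_lerch_extension_right_halfplane:
  assumes v: "Re v > 0"
  shows "\<exists>F. entire_lerch_extension F v"
proof -
  define G where "G = (\<lambda>N z s. lerch_integral (lerch_kernel v N) z (s + of_nat N) v)"
  have G_z: "(\<lambda>z. G N z s) holomorphic_on - lerch_cut" if "Re s > - real N" for N s
    unfolding G_def using that v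
    by (intro lerch_integral_holomorphic_z holomorphic_lerch_kernel) auto
  have G_s: "G N z holomorphic_on {s. Re s > - real N}" if "z \<notin> lerch_cut" for N z
  proof -
    have "(\<lambda>s. lerch_integral (lerch_kernel v N) z s v) \<circ> (\<lambda>s. s + of_nat N)
            holomorphic_on {s. Re s > - real N}"
      using that v
      by (intro holomorphic_on_compose_gen[OF _ lerch_integral_holomorphic_s]
            holomorphic_lerch_kernel holomorphic_intros) auto
    thus ?thesis by (simp add: G_def o_def)
  qed
  have G_sums: "(\<lambda>j. z ^ j / (of_nat j + v) powr s) sums G N z s"
    if "norm z < 1" "Re s > - real N" for N z s
  proof -
    have "(\<lambda>j. (of_nat j + v) ^ N * z ^ j * (of_nat j + v) powr (- (s + of_nat N))) sums G N z s"
      unfolding G_def using that v by (intro lerch_integral_sums lerch_kernel_sums) auto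
    moreover have "(of_nat j + v) ^ N * z ^ j * (of_nat j + v) powr (- (s + of_nat N)) =
                     z ^ j / (of_nat j + v) powr s" for j
    proof -
      have nz: "of_nat j + v \<noteq> 0" using v by (auto simp: complex_eq_iff)
      have "(of_nat j + v) powr (- (s + of_nat N)) = inverse ((of_nat j + v) powr s * (of_nat j + v) ^ N)"
        unfolding powr_minus using nz by (simp add: powr_add powr_nat')
      thus ?thesis using nz by (simp only: inverse_mult_distrib) (simp add: divide_inverse)
    qed
    ultimately show ?thesis by simp
  qed
  have G_eq: "G N z s = G M z s"
    if "z \<notin> lerch_cut" "Re s > - real N" "Re s > - real M" for N M z s
  proof (rule analytic_continuation_open[of "ball 0 1" "- lerch_cut" "\<lambda>z. G N z s" "\<lambda>z. G M z s"])
    show "G N z s = G M z s" if "z \<in> ball 0 1" for z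
      using G_sums[of z N s] G_sums[of z M s] \<open>Re s > - real N\<close> \<open>Re s > - real M\<close> that
      by (auto intro: sums_unique2)
  qed (use that G_z ball_subset_Compl_lerch_cut in
        \<open>auto simp: open_Compl_lerch_cut connected_Compl_lerch_cut\<close>)
  define n where "n = (\<lambda>s. Suc (nat \<lceil>- Re s\<rceil>))"
  have n: "Re s > - real (n s)" for s unfolding n_def by linarith
  define F where "F = (\<lambda>z s. G (n s) z s)"
  have "F z holomorphic_on UNIV" if z: "z \<notin> lerch_cut" for z
  proof -
    have "F z holomorphic_on (\<Union>N\<in>UNIV. {s. Re s > - real N})"
    proof (rule holomorphic_on_UN_open)
      fix N :: nat
      show "F z holomorphic_on {s. Re s > - real N}"
        using G_s[OF z, of N]
      proof (rule holomorphic_transform)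
        show "G N z s = F z s" if "s \<in> {s. Re s > - real N}" for s
          unfolding F_def using G_eq[OF z _ n, of N s] that by simp
      qed
    qed (rule open_halfspace_Re_gt)
    also have "(\<Union>N\<in>UNIV. {s. Re s > - real N}) = UNIV"
      using n by blast
    finally show ?thesis .
  qed
  moreover have "(\<lambda>z. F z s) holomorphic_on - lerch_cut" for s
    unfolding F_def by (rule G_z[OF n])
  moreover have "(\<lambda>j. z ^ j / (of_nat j + v) powr s) sums F z s" if "norm z < 1" for z s
    unfolding F_def using that n by (rule G_sums)
  ultimately have "entire_lerch_extension F v"
    unfolding entire_lerch_extension_def by (intro conjI allI impI)
  thus ?thesis by blast
qed

text \<open>
  Splitting off finitely many terms of the series moves \<open>v\<close> into the right
  half-plane.
\<close>
lemma entire_lerch_extension_exists: "\<exists>F. entire_lerch_extension F v"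
proof -
  obtain N :: nat where N: "- Re v < real N" using reals_Archimedean2 by blast
  hence "Re (of_nat N + v) > 0" by simp
  then obtain F where F: "entire_lerch_extension F (of_nat N + v)"
    using entire_lerch_extension_right_halfplane by blast
  define H where "H = (\<lambda>z s. z ^ N * F z s + (\<Sum>j<N. z ^ j / (of_nat j + v) powr s))"
  have "(\<lambda>z. H z s) holomorphic_on - lerch_cut" for s
    using F unfolding H_def entire_lerch_extension_def lerch_term_eq
    by (auto intro!: holomorphic_on_add holomorphic_on_mult holomorphic_on_power
                     holomorphic_on_sum holomorphic_on_const holomorphic_on_ident)
  moreover have "H z holomorphic_on UNIV" if "z \<notin> lerch_cut" for z
    using F that unfolding H_def entire_lerch_extension_def lerch_term_eq
    by (auto intro!: holomorphic_on_add holomorphic_on_mult holomorphic_on_sum holomorphic_on_const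
                     holomorphic_on_powr_right holomorphic_on_minus holomorphic_on_ident)
  moreover have "(\<lambda>j. z ^ j / (of_nat j + v) powr s) sums H z s" if "norm z < 1" for z s
  proof -
    have "(\<lambda>j. z ^ j / (of_nat j + (of_nat N + v)) powr s) sums F z s"
      using F that by (simp add: entire_lerch_extension_def)
    from sums_mult[OF this, of "z ^ N"]
    have "(\<lambda>j. z ^ (j + N) / (of_nat (j + N) + v) powr s) sums (z ^ N * F z s)"
      by (simp add: power_add add_ac mult_ac)
    thus ?thesis unfolding H_def by (subst (asm) sums_iff_shift)
  qed
  ultimately show ?thesis unfolding entire_lerch_extension_def by blast
qed

text \<open>
  On the unit circle with \<open>Re s > 1\<close> the Lerch function is given by its series and
  not by continuation; there both sides are limits along the radius.
\<close>
lemma lerch_phi_eq_extension: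
  assumes F: "entire_lerch_extension F v" and z: "z \<notin> lerch_cut"
  shows "lerch_phi z s v = F z s"
proof -
  have hol: "(\<lambda>z. F z s) holomorphic_on - lerch_cut"
    and ser: "F y s = lerch_series y s v" if "norm y < 1" for y
    using F that by (auto simp: entire_lerch_extension_def lerch_series_def sums_iff)
  have "z \<noteq> 1" using z by (auto simp: lerch_cut_iff)
  consider "norm z < 1" | "norm z = 1" "Re s > 1" | "norm z \<ge> 1" "\<not>(norm z = 1 \<and> Re s > 1)"
    by linarith
  thus ?thesis
  proof cases
    case 1
    thus ?thesis using ser by (simp add: lerch_phi_def)
  next
    case 2
    \<comment> \<open>the offset 2 keeps the scale factors in \<open>[1/2, 1)\<close>\<close>
    define x where "x = (\<lambda>n. of_real (1 - 1 / real (n + 2)) * z)"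
    have x: "x \<longlonglongrightarrow> z"
    proof -
      have "(\<lambda>n. 1 - 1 / real (n + 2)) \<longlonglongrightarrow> 1 - 0"
        by (intro tendsto_intros LIMSEQ_ignore_initial_segment[where f = "\<lambda>n. 1 / real n"] lim_1_over_n)
      hence "(\<lambda>n. complex_of_real (1 - 1 / real (n + 2)) * z) \<longlonglongrightarrow> of_real (1 - 0) * z"
        by (intro tendsto_mult tendsto_const tendsto_of_real)
      thus ?thesis by (simp add: x_def)
    qed
    have nx: "norm (x n) < 1" for n
      using 2 unfolding x_def norm_mult norm_of_real by (simp add: field_simps)
    have "(\<lambda>n. F (x n) s) \<longlonglongrightarrow> F z s"
    proof -
      have "isCont (\<lambda>z. F z s) z"
        using hol[of 0] z open_Compl_lerch_cut
        by (metis ComplI continuous_on_eq_continuous_at holomorphic_on_imp_continuous_on norm_zero zero_less_one)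
      thus ?thesis using x isCont_tendsto_compose by blast
    qed
    moreover have "(\<lambda>n. F (x n) s) \<longlonglongrightarrow> lerch_series z s v"
    proof -
      have "(\<lambda>n. lerch_series (x n) s v) \<longlonglongrightarrow> lerch_series z s v"
        using 2 nx by (intro continuous_on_tendsto_compose[OF continuous_on_lerch_series_unit x])
                      (auto simp: less_imp_le)
      thus ?thesis by (simp add: ser nx)
    qed
    ultimately have "F z s = lerch_series z s v" by (rule LIMSEQ_unique)
    thus ?thesis using 2 by (simp add: lerch_phi_def)
  next
    case 3
    have "analytic_continuation (\<lambda>z. lerch_series z s v) (ball 0 1) (- lerch_cut) z = F z s"
      using hol[of 0] ser z ball_subset_Compl_lerch_cut
      by (intro analytic_continuation_eq[where g = "\<lambda>z. F z s"] open_Compl_lerch_cut connected_Compl_lerch_cut) auto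
    thus ?thesis using 3 \<open>z \<noteq> 1\<close> by (auto simp: lerch_phi_def)
  qed
qed

lemma lerch_phi_holomorphic_z: "(\<lambda>z. lerch_phi z s v) holomorphic_on - lerch_cut"
proof -
  obtain F where F: "entire_lerch_extension F v" using entire_lerch_extension_exists by blast
  hence "(\<lambda>z. F z s) holomorphic_on - lerch_cut" by (simp add: entire_lerch_extension_def)
  thus ?thesis by (rule holomorphic_transform) (simp add: lerch_phi_eq_extension[OF F])
qed

lemma lerch_phi_holomorphic_s:
  assumes "z \<notin> lerch_cut"
  shows "(\<lambda>s. lerch_phi z s v) holomorphic_on UNIV"
proof -
  obtain F where F: "entire_lerch_extension F v" using entire_lerch_extension_exists by blast
  hence "F z holomorphic_on UNIV" using assms by (simp add: entire_lerch_extension_def)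
  thus ?thesis by (rule holomorphic_transform) (simp add: lerch_phi_eq_extension[OF F assms])
qed

lemma lerch_phi_sums:
  assumes "norm z < 1 \<or> norm z = 1 \<and> Re s > 1"
  shows "(\<lambda>j. z ^ j / (of_nat j + v) powr s) sums lerch_phi z s v"
proof (cases "norm z < 1")
  case True
  obtain F where F: "entire_lerch_extension F v" using entire_lerch_extension_exists by blast
  hence "(\<lambda>j. z ^ j / (of_nat j + v) powr s) sums F z s"
    using True by (simp add: entire_lerch_extension_def)
  moreover have "z \<notin> lerch_cut" using True ball_subset_Compl_lerch_cut by auto
  ultimately show ?thesis using lerch_phi_eq_extension[OF F] by simp
next
  case False
  thus ?thesis using assms lerch_series_converges_unit[of z s v] by (auto simp: lerch_phi_def)
qed

section \<open>The Hurwitz series\<close>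

text \<open>
  Uniformity in both variables together, because the recurrence for the Hurwitz zeta function
  integrates over \<open>v\<close>.
\<close>
lemma hurwitz_uniform_limit:
  fixes \<sigma> T :: real
  assumes \<sigma>: "\<sigma> > 1"
  shows "uniform_limit ({s. \<sigma> \<le> Re s \<and> \<bar>Im s\<bar> \<le> T} \<times> {v. 0 \<le> Re v})
           (\<lambda>n (s, v). \<Sum>j<n. (of_nat j + v) powr (-s)) (\<lambda>(s, v). lerch_series 1 s v) sequentially"
proof -
  have "uniform_limit ({s. \<sigma> \<le> Re s \<and> \<bar>Im s\<bar> \<le> T} \<times> {v. 0 \<le> Re v})
          (\<lambda>n x. \<Sum>j<n. (of_nat j + snd x) powr (- fst x))
          (\<lambda>x. \<Sum>j. (of_nat j + snd x) powr (- fst x)) sequentially"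
  proof (rule Weierstrass_m_test_ev)
    show "\<forall>\<^sub>F j in sequentially. \<forall>x\<in>{s. \<sigma> \<le> Re s \<and> \<bar>Im s\<bar> \<le> T} \<times> {v. 0 \<le> Re v}.
            norm ((of_nat j + snd x) powr (- fst x)) \<le> exp (pi * T) * real j powr (-\<sigma>)"
      using eventually_ge_at_top[of 1]
    proof eventually_elim
      case (elim j)
      show ?case
      proof
        fix x assume x: "x \<in> {s. \<sigma> \<le> Re s \<and> \<bar>Im s\<bar> \<le> T} \<times> {v. 0 \<le> Re v}"
        show "norm ((of_nat j + snd x) powr (- fst x)) \<le> exp (pi * T) * real j powr (-\<sigma>)"
          using norm_shifted_powr_le[of "real j" "snd x" \<sigma> "fst x" T] x elim \<sigma> by auto
      qed
    qed
    show "summable (\<lambda>j. exp (pi * T) * real j powr (-\<sigma>))"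
      using \<sigma> by (intro summable_mult) (simp add: summable_real_powr_iff)
  qed
  thus ?thesis by (simp add: case_prod_beta' lerch_series_def powr_minus divide_inverse)
qed

lemma continuous_on_powr_right_halfplane:
  fixes f g :: "'a :: topological_space \<Rightarrow> complex"
  assumes "continuous_on A f" "continuous_on A g" "\<And>x. x \<in> A \<Longrightarrow> Re (f x) > 0"
  shows "continuous_on A (\<lambda>x. f x powr g x)"
proof -
  have nz: "f x \<notin> \<real>\<^sub>\<le>\<^sub>0" "f x \<noteq> 0" if "x \<in> A" for x
    using assms(3)[OF that] by (auto simp: complex_nonpos_Reals_iff)
  have "continuous_on A (\<lambda>x. exp (g x * Ln (f x)))"
    using nz by (intro continuous_intros assms) auto
  also have "?this \<longleftrightarrow> ?thesis"
    using nz by (intro continuous_on_cong) (auto simp: powr_def)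
  finally show ?thesis .
qed

lemma continuous_on_hurwitz_series:
  "continuous_on ({s. Re s > 1} \<times> {v. Re v > 0}) (\<lambda>(s, v). lerch_series 1 s v)"
proof (rule continuous_at_imp_continuous_on, clarify)
  fix s v :: complex assume s: "Re s > 1" and v: "Re v > 0"
  obtain \<sigma> where \<sigma>: "1 < \<sigma>" "\<sigma> < Re s" using s dense by blast
  define T where "T = \<bar>Im s\<bar> + 1"
  define A where "A = {s. \<sigma> < Re s} \<inter> {s. Im s < T} \<inter> {s. Im s > -T}"
  have "open A"
    unfolding A_def by (intro open_Int open_halfspace_Re_gt open_halfspace_Im_lt open_halfspace_Im_gt)
  hence "open (A \<times> {v. Re v > 0})" by (intro open_Times open_halfspace_Re_gt)
  moreover have "(s, v) \<in> A \<times> {v. Re v > 0}" using \<sigma> v by (auto simp: A_def T_def)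
  moreover have "continuous_on (A \<times> {v. Re v > 0}) (\<lambda>(s, v). lerch_series 1 s v)"
  proof (rule uniform_limit_theorem)
    show "uniform_limit (A \<times> {v. Re v > 0}) (\<lambda>n (s, v). \<Sum>j<n. (of_nat j + v) powr (-s))
            (\<lambda>(s, v). lerch_series 1 s v) sequentially"
      by (rule uniform_limit_on_subset[OF hurwitz_uniform_limit[OF \<sigma>(1), of T]]) (auto simp: A_def)
    show "\<forall>\<^sub>F n in sequentially. continuous_on (A \<times> {v. Re v > 0})
            (\<lambda>(s, v). \<Sum>j<n. (of_nat j + v) powr (-s))"
      unfolding case_prod_beta'
    proof (intro always_eventually allI continuous_on_sum)
      fix j :: nat
      show "continuous_on (A \<times> {v. Re v > 0}) (\<lambda>x. (of_nat j + snd x) powr (- fst x))"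
        by (intro continuous_on_powr_right_halfplane continuous_intros) auto
    qed
  qed simp
  ultimately show "isCont (\<lambda>(s, v). lerch_series 1 s v) (s, v)"
    using continuous_on_eq_continuous_at by blast
qed

lemma holomorphic_on_hurwitz_series:
  assumes "Re v > 0"
  shows "(\<lambda>s. lerch_series 1 s v) holomorphic_on {s. Re s > 1}"
proof (rule holomorphic_uniform_sequence)
  show "open {s::complex. Re s > 1}" by (rule open_halfspace_Re_gt)
  show "(\<lambda>s. \<Sum>j<n. (of_nat j + v) powr (-s)) holomorphic_on {s. Re s > 1}" for n
    by (intro holomorphic_intros)
  fix s :: complex assume "s \<in> {s. Re s > 1}"
  hence s: "Re s > 1" by simp
  define d where "d = (Re s - 1) / 2"
  have d: "d > 0" "Re s = 1 + 2 * d" using s by (simp_all add: d_def field_simps)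
  have sub: "1 + d \<le> Re y" "\<bar>Im y\<bar> \<le> \<bar>Im s\<bar> + d" if "y \<in> cball s d" for y
    using that abs_Re_le_cmod[of "s - y"] abs_Im_le_cmod[of "s - y"] d
    by (simp_all add: dist_norm)
  have "uniform_limit (cball s d) (\<lambda>n s. \<Sum>j<n. (of_nat j + v) powr (-s)) (\<lambda>s. lerch_series 1 s v) sequentially"
    unfolding uniform_limit_iff
  proof (intro allI impI)
    fix e :: real assume "e > 0"
    with hurwitz_uniform_limit[of "1 + d" "\<bar>Im s\<bar> + d"] d(1)
    have "\<forall>\<^sub>F n in sequentially. \<forall>x\<in>{s'. 1 + d \<le> Re s' \<and> \<bar>Im s'\<bar> \<le> \<bar>Im s\<bar> + d} \<times> {v. 0 \<le> Re v}.
            dist (case x of (s, v) \<Rightarrow> \<Sum>j<n. (of_nat j + v) powr (-s)) (case x of (s, v) \<Rightarrow> lerch_series 1 s v) < e"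
      unfolding uniform_limit_iff by simp
    thus "\<forall>\<^sub>F n in sequentially. \<forall>y\<in>cball s d.
            dist (\<Sum>j<n. (of_nat j + v) powr (-y)) (lerch_series 1 y v) < e"
    proof eventually_elim
      case (elim n)
      show ?case
      proof
        fix y assume "y \<in> cball s d"
        with sub[of y] assms have "(y, v) \<in> {s'. 1 + d \<le> Re s' \<and> \<bar>Im s'\<bar> \<le> \<bar>Im s\<bar> + d} \<times> {v. 0 \<le> Re v}"
          by auto
        from bspec[OF elim this]
        show "dist (\<Sum>j<n. (of_nat j + v) powr (-y)) (lerch_series 1 y v) < e" by simp
      qed
    qed
  qed
  moreover have "cball s d \<subseteq> {s. Re s > 1}"
  proof
    fix y assume "y \<in> cball s d" thus "y \<in> {s. Re s > 1}" using sub(1)[of y] d(1) by simp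
  qed
  ultimately show "\<exists>d>0. cball s d \<subseteq> {s. Re s > 1} \<and>
      uniform_limit (cball s d) (\<lambda>n s. \<Sum>j<n. (of_nat j + v) powr (-s)) (\<lambda>s. lerch_series 1 s v) sequentially"
    using d by blast
qed

text \<open>
  Taylor's formula of first order, with integral remainder, for the function \<open>w powr (1 -
  s)\<close> and the step from \<open>w\<close> to \<open>w + 1\<close>.
\<close>
lemma has_integral_powr_remainder:
  assumes w: "Re w > 0"
  shows "((\<lambda>y. s * (s - 1) * ((1 - of_real y) * (w + of_real y) powr (-(s + 1)))) has_integral
           ((s - 1) * w powr (-s) + (w + 1) powr (1 - s) - w powr (1 - s))) {0..1}"
proof -
  \<comment> \<open>an antiderivative, found by integrating by parts\<close>
  define A where "A = (\<lambda>y. (w + y) powr (1 - s) - (s - 1) * ((1 - y) * (w + y) powr (-s)))"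
  have "((\<lambda>y. s * (s - 1) * ((1 - of_real y) * (w + of_real y) powr (-(s + 1)))) has_integral
           (A (of_real 1) - A (of_real 0))) {0..1}"
  proof (rule fundamental_theorem_of_calculus)
    fix y :: real assume y: "y \<in> {0..1}"
    have nn: "w + of_real y \<notin> \<real>\<^sub>\<le>\<^sub>0" using w y by (auto simp: complex_nonpos_Reals_iff)
    have "(A has_field_derivative
             ((1 - s) * (w + of_real y) powr (1 - s - 1) * 1 -
              (s - 1) * ((- 1) * (w + of_real y) powr (-s) +
                         (- s * (w + of_real y) powr (-s - 1) * 1) * (1 - of_real y)))) (at (of_real y))"
      unfolding A_def
      by (intro DERIV_diff DERIV_cmult DERIV_mult DERIV_chain2[OF has_field_derivative_powr] nn)
         (auto intro!: derivative_eq_intros)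
    also have "(1 - s) * (w + of_real y) powr (1 - s - 1) * 1 -
              (s - 1) * ((- 1) * (w + of_real y) powr (-s) +
                         (- s * (w + of_real y) powr (-s - 1) * 1) * (1 - of_real y)) =
              s * (s - 1) * ((1 - of_real y) * (w + of_real y) powr (-(s + 1)))"
    proof -
      have "-(s + 1) = - s - 1" "1 - s - 1 = - s" by simp_all
      thus ?thesis by (simp only:) (simp add: ring_distribs mult_ac)
    qed
    finally have "(A has_field_derivative s * (s - 1) * ((1 - of_real y) * (w + of_real y) powr (-(s + 1)))) (at (of_real y))" .
    thus "((\<lambda>y. A (of_real y)) has_vector_derivative
             s * (s - 1) * ((1 - of_real y) * (w + of_real y) powr (-(s + 1)))) (at y within {0..1})"
      by (rule has_vector_derivative_real_field)
  qed simp
  thus ?thesis by (simp add: A_def algebra_simps)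
qed

lemma tendsto_shifted_powr_zero:
  assumes v: "Re v > 0" and s: "Re s > 0"
  shows "(\<lambda>j. (of_nat j + v) powr (-s)) \<longlonglongrightarrow> 0"
proof (rule Lim_null_comparison)
  show "\<forall>\<^sub>F j in sequentially. norm ((of_nat j + v) powr (-s)) \<le> exp (pi * \<bar>Im s\<bar>) * real j powr (- Re s)"
    using eventually_ge_at_top[of 1]
  proof eventually_elim
    case (elim j)
    thus ?case using norm_shifted_powr_le[of "real j" v "Re s" s "\<bar>Im s\<bar>"] assms by simp
  qed
  have "(\<lambda>j. exp (pi * \<bar>Im s\<bar>) * real j powr (- Re s)) \<longlonglongrightarrow> exp (pi * \<bar>Im s\<bar>) * 0"
    using s by (intro tendsto_mult tendsto_const tendsto_neg_powr filterlim_real_sequentially) auto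
  thus "(\<lambda>j. exp (pi * \<bar>Im s\<bar>) * real j powr (- Re s)) \<longlonglongrightarrow> 0" by simp
qed

text \<open>
  The sum of Taylor's formula over \<open>w = v + j\<close>: the first-order terms give the
  Hurwitz series, the differences of \<open>(j+v) powr (1 - s)\<close> telescope, and the
  remainders give an integral of the Hurwitz series at \<open>s + 1\<close>.
\<close>
lemma hurwitz_series_recurrence:
  assumes v: "Re v > 0" and s: "Re s > 1"
  shows "(s - 1) * lerch_series 1 s v = v powr (1 - s) +
           (s - 1) * integral {0..1} (\<lambda>y. (1 - of_real y) * (s * lerch_series 1 (s + 1) (v + of_real y)))"
proof -
  define f where "f = (\<lambda>j y. s * (s - 1) * ((1 - of_real y) * (of_nat j + v + of_real y) powr (-(s + 1))))"
  define I where "I = (\<lambda>j. (s - 1) * (of_nat j + v) powr (-s) +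
                        ((of_nat j + v + 1) powr (1 - s) - (of_nat j + v) powr (1 - s)))"
  have f_int: "(f j has_integral I j) {0..1}" for j
    using has_integral_powr_remainder[of "of_nat j + v" s] v by (simp add: f_def I_def add_diff_eq)
  have I_sums: "I sums ((s - 1) * lerch_series 1 s v + (0 - (of_nat 0 + v) powr (1 - s)))"
  proof -
    have "(\<lambda>j. (of_nat j + v) powr (1 - s)) \<longlonglongrightarrow> 0"
      using tendsto_shifted_powr_zero[of v "s - 1"] assms by simp
    from telescope_sums[OF this] have "(\<lambda>j. (of_nat j + v + 1) powr (1 - s) - (of_nat j + v) powr (1 - s)) sums
        (0 - (of_nat 0 + v) powr (1 - s))"
      by (simp add: add_ac)
    moreover have "(\<lambda>j. (s - 1) * (of_nat j + v) powr (-s)) sums ((s - 1) * lerch_series 1 s v)"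
      using lerch_series_converges_unit[of 1 s v] s
      by (intro sums_mult) (simp add: powr_minus divide_inverse)
    ultimately show ?thesis unfolding I_def by (intro sums_add)
  qed
  define g where "g = (\<lambda>y. (s - 1) * ((1 - of_real y) * (s * lerch_series 1 (s + 1) (v + of_real y))))"
  define M where "M = (\<lambda>j. norm (s * (s - 1)) * (exp (pi * \<bar>Im (s+1)\<bar>) * real j powr (- Re (s+1))))"
  have "uniform_limit {0..1} (\<lambda>n y. \<Sum>j<n. f j y) (\<lambda>y. \<Sum>j. f j y) sequentially"
  proof (rule Weierstrass_m_test_ev)
    show "\<forall>\<^sub>F j in sequentially. \<forall>y\<in>{0..1}. norm (f j y) \<le> M j"
      using eventually_ge_at_top[of 1]
    proof eventually_elim
      case (elim j)
      show ?case
      proof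
        fix y :: real assume y: "y \<in> {0..1}"
        have "norm ((of_real (real j) + (v + of_real y)) powr (-(s+1))) \<le> exp (pi * \<bar>Im (s+1)\<bar>) * real j powr (- Re (s+1))"
          using y elim v s by (intro norm_shifted_powr_le) auto
        hence b: "norm ((of_nat j + v + of_real y) powr (-(s+1))) \<le> exp (pi * \<bar>Im (s+1)\<bar>) * real j powr (- Re (s+1))"
          by (simp add: add_ac)
        have "norm (1 - complex_of_real y) \<le> 1"
          using y by (metis abs_of_nonneg atLeastAtMost_iff diff_ge_0_iff_ge diff_le_eq le_add_same_cancel1 norm_of_real of_real_1 of_real_diff)
        hence "norm (1 - complex_of_real y) * norm ((of_nat j + v + of_real y) powr (-(s+1))) \<le>
                 1 * (exp (pi * \<bar>Im (s+1)\<bar>) * real j powr (- Re (s+1)))"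
          using b by (intro mult_mono) auto
        thus "norm (f j y) \<le> M j"
          unfolding f_def M_def norm_mult[of "s * (s-1)"] norm_mult[of "1 - of_real y"]
          by (intro mult_left_mono) auto
      qed
    qed
    show "summable M"
      unfolding M_def using s by (intro summable_mult) (simp add: summable_real_powr_iff)
  qed
  also have "?this \<longleftrightarrow> uniform_limit {0..1} (\<lambda>n y. \<Sum>j<n. f j y) g sequentially"
  proof (rule uniform_limit_cong')
    fix y :: real assume y: "y \<in> {0..1}"
    have "(\<lambda>j. s * (s - 1) * ((1 - of_real y) * (1 ^ j / (of_nat j + (v + of_real y)) powr (s + 1))))
            sums (s * (s - 1) * ((1 - of_real y) * lerch_series 1 (s + 1) (v + of_real y)))"
      using s by (intro sums_mult lerch_series_converges_unit) auto
    also have "(\<lambda>j. s * (s - 1) * ((1 - of_real y) * (1 ^ j / (of_nat j + (v + of_real y)) powr (s + 1)))) = (\<lambda>j. f j y)"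
      unfolding lerch_term_eq f_def by (simp add: add_ac)
    finally show "(\<Sum>j. f j y) = g y" by (simp add: sums_iff g_def mult_ac)
  qed auto
  finally have ul: "uniform_limit {0..1} (\<lambda>n y. \<Sum>j<n. f j y) g sequentially" .
  have cont: "continuous_on {0..1} (\<lambda>y. \<Sum>j<n. f j y)" for n
  proof (intro continuous_on_sum)
    fix j
    have "continuous_on {0..1} (\<lambda>y. (of_nat j + v + complex_of_real y) powr (-(s + 1)))"
      using v by (intro continuous_on_powr_right_halfplane continuous_intros) auto
    thus "continuous_on {0..1} (f j)"
      unfolding f_def by (intro continuous_on_mult continuous_on_const continuous_on_diff continuous_on_of_real continuous_on_id)
  qed
  obtain S J where S: "\<And>n. ((\<lambda>y. \<Sum>j<n. f j y) has_integral S n) {0..1}"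
    and J: "(g has_integral J) {0..1}" and lim: "S \<longlonglongrightarrow> J"
    using uniform_limit_integral[OF ul cont] by (metis sequentially_bot)
  have "S n = (\<Sum>j<n. I j)" for n
    using S[of n] has_integral_sum[of "{..<n}" f I "{0..1}"] f_int has_integral_unique by blast
  hence "S = (\<lambda>n. \<Sum>j<n. I j)" by blast
  hence "I sums J" using lim by (simp add: sums_def)
  hence "J = (s - 1) * lerch_series 1 s v - v powr (1 - s)"
    using I_sums sums_unique2 by fastforce
  moreover have "J = (s - 1) * integral {0..1} (\<lambda>y. (1 - of_real y) * (s * lerch_series 1 (s + 1) (v + of_real y)))"
    using integral_unique[OF J] unfolding g_def by (simp only: integral_mult_right)
  ultimately show ?thesis by (simp add: algebra_simps)
qed

section \<open>Continuation of the Hurwitz zeta function\<close>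

text \<open>
  The factor \<open>s - 1\<close> cancels the pole. Joint continuity is carried along so that
  integrals over \<open>v\<close> are again continuous, and are holomorphic in \<open>s\<close>.
\<close>
definition hurwitz_extension :: "(complex \<Rightarrow> complex \<Rightarrow> complex) \<Rightarrow> real \<Rightarrow> bool" where
  "hurwitz_extension Z a \<longleftrightarrow>
     continuous_on ({s. Re s > a} \<times> {v. Re v > 0}) (\<lambda>(s, v). Z s v) \<and>
     (\<forall>v. Re v > 0 \<longrightarrow> (\<lambda>s. Z s v) holomorphic_on {s. Re s > a}) \<and>
     (\<forall>s v. Re s > 1 \<longrightarrow> Re v > 0 \<longrightarrow> Z s v = (s - 1) * lerch_series 1 s v)"

lemma hurwitz_extension_1: "hurwitz_extension (\<lambda>s v. (s - 1) * lerch_series 1 s v) 1"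
  unfolding hurwitz_extension_def
proof (intro conjI allI impI refl)
  show "continuous_on ({s. Re s > 1} \<times> {v. Re v > 0}) (\<lambda>(s, v). (s - 1) * lerch_series 1 s v)"
    using continuous_on_hurwitz_series unfolding case_prod_beta'
    by (intro continuous_intros)
qed (intro holomorphic_intros holomorphic_on_hurwitz_series)

lemma holomorphic_on_integral_01:
  assumes U: "open U"
    and cont: "continuous_on (U \<times> {0..1}) (\<lambda>(s, y). f s y)"
    and hol: "\<And>y. y \<in> {0..1} \<Longrightarrow> (\<lambda>s. f s y) holomorphic_on U"
  shows "(\<lambda>s. integral {0..1::real} (f s)) holomorphic_on U"
proof -
  have c1: "continuous_on {0..1} (f s)" if "s \<in> U" for s
  proof -
    have "continuous_on {0..1::real} (\<lambda>y. (s, y))" by (intro continuous_intros)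
    from continuous_on_compose2[OF cont this] that show ?thesis by auto
  qed
  have "(\<lambda>s. \<integral>y. f s y \<partial>restrict_space lborel {0..1}) holomorphic_on U"
  proof (rule holomorphic_on_lebesgue_integral[OF U])
    show "f s \<in> borel_measurable (restrict_space lborel {0..1})" if "s \<in> U" for s
      using borel_measurable_continuous_on_restrict[OF c1[OF that]]
      by (simp cong: measurable_cong_sets restrict_space_sets_cong)
    show "(\<lambda>s. f s y) holomorphic_on U" if "y \<in> space (restrict_space lborel {0..1})" for y
      using that by (intro hol) (simp add: space_restrict_space)
    fix s assume "s \<in> U"
    then obtain e where e: "e > 0" "cball s e \<subseteq> U" using U open_contains_cball by blast
    have "compact ((\<lambda>(s, y). f s y) ` (cball s e \<times> {0..1}))"
    proof (rule compact_continuous_image)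
      show "continuous_on (cball s e \<times> {0..1}) (\<lambda>(s, y). f s y)"
        using e(2) by (intro continuous_on_subset[OF cont] Sigma_mono) auto
      show "compact (cball s e \<times> {0..1::real})" by (intro compact_Times compact_cball compact_Icc)
    qed
    hence "bounded ((\<lambda>(s, y). f s y) ` (cball s e \<times> {0..1}))" by (rule compact_imp_bounded)
    then obtain C where "\<forall>x\<in>(\<lambda>(s, y). f s y) ` (cball s e \<times> {0..1}). norm x \<le> C"
      unfolding bounded_iff by blast
    hence C: "norm (f x y) \<le> C" if "x \<in> cball s e" "y \<in> {0..1}" for x y
      using that by force
    have "integrable (restrict_space lborel {0..1::real}) (\<lambda>_. C)"
      by (subst integrable_restrict_space) (auto intro!: integrable_real_indicator)
    thus "\<exists>e>0. \<exists>h. cball s e \<subseteq> U \<and> integrable (restrict_space lborel {0..1}) h \<and>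
            (\<forall>y\<in>cball s e. \<forall>t\<in>space (restrict_space lborel {0..1}). norm (f y t) \<le> h t)"
      using e C by (intro exI[of _ e] exI[of _ "\<lambda>_. C"]) (auto simp: space_restrict_space)
  qed
  thus ?thesis
  proof (rule holomorphic_transform)
    fix s assume "s \<in> U"
    hence "set_integrable lborel {0..1} (f s)" by (intro borel_integrable_atLeastAtMost' c1)
    from set_borel_integral_eq_integral(2)[OF this]
    show "(\<integral>y. f s y \<partial>restrict_space lborel {0..1}) = integral {0..1} (f s)"
      by (subst integral_restrict_space) (auto simp: set_lebesgue_integral_def)
  qed
qed

text \<open>
  The right-hand side of the recurrence evaluates \<open>Z\<close> at \<open>s + 1\<close> and
  therefore makes sense one unit further to the left.
\<close>
lemma hurwitz_extension_step:
  assumes Z: "hurwitz_extension Z a" and a: "a \<le> 1"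
  shows "hurwitz_extension
           (\<lambda>s v. v powr (1 - s) + (s - 1) * integral {0..1} (\<lambda>y. (1 - of_real y) * Z (s + 1) (v + of_real y))) (a - 1)"
proof -
  have Zc: "continuous_on ({s. Re s > a} \<times> {v. Re v > 0}) (\<lambda>x. Z (fst x) (snd x))"
    and Zh: "\<And>v. Re v > 0 \<Longrightarrow> (\<lambda>s. Z s v) holomorphic_on {s. Re s > a}"
    and Zs: "\<And>s v. Re s > 1 \<Longrightarrow> Re v > 0 \<Longrightarrow> Z s v = (s - 1) * lerch_series 1 s v"
    using Z by (auto simp: hurwitz_extension_def case_prod_beta')
  define U where "U = {s::complex. Re s > a - 1}"
  have U: "open U" unfolding U_def by (rule open_halfspace_Re_gt)
  show ?thesis
    unfolding hurwitz_extension_def U_def[symmetric]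
  proof (intro conjI allI impI)
    have "continuous_on (U \<times> {v. Re v > 0})
            (\<lambda>x. integral (cbox 0 1) (\<lambda>y. (1 - of_real y) * Z (fst x + 1) (snd x + of_real y)))"
    proof (rule integral_continuous_on_param)
      have "continuous_on ((U \<times> {v. Re v > 0}) \<times> cbox 0 (1::real))
              (\<lambda>p. Z (fst (fst p + (1, of_real (snd p)))) (snd (fst p + (1, of_real (snd p)))))"
        by (rule continuous_on_compose2[OF Zc])
           (auto intro!: continuous_intros simp: U_def)
      thus "continuous_on ((U \<times> {v. Re v > 0}) \<times> cbox 0 (1::real))
              (\<lambda>(x, y). (1 - of_real y) * Z (fst x + 1) (snd x + of_real y))"
        unfolding case_prod_beta' by (intro continuous_intros) simp
    qed
    moreover have "continuous_on (U \<times> {v. Re v > 0}) (\<lambda>x. snd x powr (1 - fst x))"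
      by (intro continuous_on_powr_right_halfplane continuous_intros) auto
    ultimately show "continuous_on (U \<times> {v. Re v > 0}) (\<lambda>(s, v). v powr (1 - s) +
            (s - 1) * integral {0..1} (\<lambda>y. (1 - of_real y) * Z (s + 1) (v + of_real y)))"
      unfolding case_prod_beta' by (intro continuous_intros) auto
  next
    fix v :: complex assume v: "Re v > 0"
    have "(\<lambda>s. integral {0..1} (\<lambda>y. (1 - of_real y) * Z (s + 1) (v + of_real y))) holomorphic_on U"
    proof (rule holomorphic_on_integral_01[OF U])
      have "continuous_on (U \<times> {0..1::real})
              (\<lambda>p. Z (fst (fst p + 1, v + of_real (snd p))) (snd (fst p + 1, v + of_real (snd p))))"
        by (rule continuous_on_compose2[OF Zc])
           (use v in \<open>auto intro!: continuous_intros simp: U_def\<close>)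
      thus "continuous_on (U \<times> {0..1::real}) (\<lambda>(s, y). (1 - of_real y) * Z (s + 1) (v + of_real y))"
        unfolding case_prod_beta' by (intro continuous_intros) simp
      fix y :: real assume y: "y \<in> {0..1}"
      have "(\<lambda>s. Z s (v + of_real y)) \<circ> (\<lambda>s. s + 1) holomorphic_on U"
        using v y by (intro holomorphic_on_compose_gen[OF _ Zh] holomorphic_intros) (auto simp: U_def)
      thus "(\<lambda>s. (1 - of_real y) * Z (s + 1) (v + of_real y)) holomorphic_on U"
        unfolding o_def by (intro holomorphic_on_mult holomorphic_on_const)
    qed
    thus "(\<lambda>s. v powr (1 - s) + (s - 1) * integral {0..1} (\<lambda>y. (1 - of_real y) * Z (s + 1) (v + of_real y)))
            holomorphic_on U"
      by (intro holomorphic_on_add holomorphic_on_mult holomorphic_on_powr_right holomorphic_on_diff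
            holomorphic_on_const holomorphic_on_ident)
  next
    fix s v :: complex assume s: "Re s > 1" and v: "Re v > 0"
    have "integral {0..1} (\<lambda>y. (1 - of_real y) * Z (s + 1) (v + of_real y)) =
            integral {0..1} (\<lambda>y. (1 - of_real y) * (s * lerch_series 1 (s + 1) (v + of_real y)))"
      using s v by (intro integral_cong) (simp add: Zs)
    thus "v powr (1 - s) + (s - 1) * integral {0..1} (\<lambda>y. (1 - of_real y) * Z (s + 1) (v + of_real y)) =
            (s - 1) * lerch_series 1 s v"
      using hurwitz_series_recurrence[OF v s] by simp
  qed
qed

lemma hurwitz_extension_exists: "\<exists>Z. hurwitz_extension Z (1 - real N)"
proof (induction N)
  case 0
  thus ?case using hurwitz_extension_1 by auto
next
  case (Suc N)
  then obtain Z where "hurwitz_extension Z (1 - real N)" by blast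
  from hurwitz_extension_step[OF this] show ?case by (auto simp: algebra_simps)
qed

text \<open>
  The extensions to the half-planes \<open>Re s > 1 - N\<close> agree on overlaps by the
  identity theorem.
\<close>
lemma hurwitz_entire_right_halfplane:
  assumes v: "Re v > 0"
  shows "\<exists>g. g holomorphic_on UNIV \<and> (\<forall>s. Re s > 1 \<longrightarrow> g s = (s - 1) * lerch_series 1 s v)"
proof -
  obtain Z where Z: "\<And>N. hurwitz_extension (Z N) (1 - real N)"
    using hurwitz_extension_exists by metis
  have hol: "(\<lambda>s. Z N s v) holomorphic_on {s. Re s > 1 - real N}" for N
    using Z v by (auto simp: hurwitz_extension_def)
  have ser: "Z N s v = (s - 1) * lerch_series 1 s v" if "Re s > 1" for N s
    using Z v that by (auto simp: hurwitz_extension_def)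
  have eq: "Z N s v = Z M s v" if "Re s > 1 - real N" "Re s > 1 - real M" for N M s
  proof (rule analytic_continuation_open[of "{s. Re s > 1}"
           "{s. Re s > 1 - real N} \<inter> {s. Re s > 1 - real M}" "\<lambda>s. Z N s v" "\<lambda>s. Z M s v"])
    show "connected ({s. Re s > 1 - real N} \<inter> {s. Re s > 1 - real M})"
      by (intro convex_connected convex_Int convex_halfspace_Re_gt)
    show "{s::complex. 1 < Re s} \<noteq> {}" by (auto intro: exI[of _ 2])
    show "(\<lambda>s. Z N s v) holomorphic_on {s. Re s > 1 - real N} \<inter> {s. Re s > 1 - real M}"
         "(\<lambda>s. Z M s v) holomorphic_on {s. Re s > 1 - real N} \<inter> {s. Re s > 1 - real M}"
      by (rule holomorphic_on_subset[OF hol], blast)+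
  qed (use that ser in \<open>auto simp: open_Int open_halfspace_Re_gt\<close>)
  define n where "n = (\<lambda>s. Suc (Suc (nat \<lceil>- Re s\<rceil>)))"
  have n: "Re s > 1 - real (n s)" for s unfolding n_def by linarith
  define g where "g = (\<lambda>s. Z (n s) s v)"
  have "g holomorphic_on (\<Union>N\<in>UNIV. {s. Re s > 1 - real N})"
  proof (rule holomorphic_on_UN_open)
    fix N :: nat
    show "g holomorphic_on {s. Re s > 1 - real N}"
      using hol[of N]
    proof (rule holomorphic_transform)
      show "Z N s v = g s" if "s \<in> {s. Re s > 1 - real N}" for s
        unfolding g_def using eq[OF _ n, of N s] that by simp
    qed
  qed (rule open_halfspace_Re_gt)
  also have "(\<Union>N\<in>UNIV. {s. Re s > 1 - real N}) = UNIV" using n by blast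
  finally have "g holomorphic_on UNIV" .
  moreover have "g s = (s - 1) * lerch_series 1 s v" if "Re s > 1" for s
    unfolding g_def using that by (rule ser)
  ultimately show ?thesis by blast
qed

lemma hurwitz_extension_punctured:
  "\<exists>g. g holomorphic_on - {1} \<and> (\<forall>s. Re s > 1 \<longrightarrow> g s = lerch_series 1 s v)"
proof -
  obtain N :: nat where N: "- Re v < real N" using reals_Archimedean2 by blast
  hence pos: "Re (of_nat N + v) > 0" by simp
  obtain g where g: "g holomorphic_on UNIV"
    "\<And>s. Re s > 1 \<Longrightarrow> g s = (s - 1) * lerch_series 1 s (of_nat N + v)"
    using hurwitz_entire_right_halfplane[OF pos] by blast
  define h where "h = (\<lambda>s. g s / (s - 1) + (\<Sum>j<N. (of_nat j + v) powr (-s)))"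
  have "h holomorphic_on - {1}"
    unfolding h_def using holomorphic_on_subset[OF g(1)]
    by (intro holomorphic_on_add holomorphic_on_divide holomorphic_on_sum holomorphic_on_powr_right
          holomorphic_on_minus holomorphic_on_diff holomorphic_on_ident holomorphic_on_const) auto
  moreover have "h s = lerch_series 1 s v" if s: "Re s > 1" for s
  proof -
    have "(\<lambda>j. 1 ^ j / (of_nat j + (of_nat N + v)) powr s) sums lerch_series 1 s (of_nat N + v)"
      using s by (intro lerch_series_converges_unit) auto
    hence "(\<lambda>j. (of_nat (j + N) + v) powr (-s)) sums lerch_series 1 s (of_nat N + v)"
      unfolding lerch_term_eq by (simp add: add_ac)
    hence "(\<lambda>j. (of_nat j + v) powr (-s)) sums
             (lerch_series 1 s (of_nat N + v) + (\<Sum>j<N. (of_nat j + v) powr (-s)))"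
      by (subst (asm) sums_iff_shift)
    moreover have "(\<lambda>j. (of_nat j + v) powr (-s)) sums lerch_series 1 s v"
      using lerch_series_converges_unit[of 1 s v] s unfolding lerch_term_eq by simp
    moreover have "s \<noteq> 1" using s by auto
    ultimately show ?thesis
      using g(2)[OF s] by (auto simp: h_def intro: sums_unique2)
  qed
  ultimately show ?thesis by blast
qed

lemma lerch_phi_1_holomorphic_s: "(\<lambda>s. lerch_phi 1 s v) holomorphic_on - {1}"
proof -
  obtain g where g: "g holomorphic_on - {1}" "\<And>s. Re s > 1 \<Longrightarrow> g s = lerch_series 1 s v"
    using hurwitz_extension_punctured by blast
  have "hurwitz_zeta s v = g s" if "s \<noteq> 1" for s
    unfolding hurwitz_zeta_def
  proof (rule analytic_continuation_eq)
    show "connected (- {1 :: complex})"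
      by (rule connected_punctured_universe) simp
    show "{s::complex. 1 < Re s} \<noteq> {}" by (auto intro: exI[of _ 2])
  qed (use that g in \<open>auto simp: open_halfspace_Re_gt\<close>)
  thus ?thesis
    by (intro holomorphic_transform[OF g(1)]) (auto simp: lerch_phi_def g)
qed

section \<open>The trisection formula\<close>

text \<open>
  Group the series into blocks of three and take the positive factor 3 out of \<open>3 n + r + v
  = 3 (n + (v + r)/3)\<close>; principal powers are multiplicative for a positive factor.
\<close>
lemma lerch_phi_trisection_series:
  assumes z: "norm z < 1 \<or> norm z = 1 \<and> Re s > 1"
  shows "lerch_phi z s v = 3 powr (-s) * (lerch_phi (z ^ 3) s (v / 3) +
           z * lerch_phi (z ^ 3) s ((v + 1) / 3) + z\<^sup>2 * lerch_phi (z ^ 3) s ((v + 2) / 3))"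
proof -
  define f where "f = (\<lambda>j. z ^ j / (of_nat j + v) powr s)"
  have z3: "norm (z ^ 3) < 1 \<or> norm (z ^ 3) = 1 \<and> Re s > 1"
    using z power_strict_mono[of "norm z" 1 3] by (auto simp: norm_power)
  have f_eq: "f (n * 3 + r) = 3 powr (-s) * (z ^ r * ((z ^ 3) ^ n / (of_nat n + (v + of_nat r) / 3) powr s))"
    for n r
  proof -
    have "of_nat (n * 3 + r) + v = 3 * (of_nat n + (v + of_nat r) / 3)" by simp
    hence "(of_nat (n * 3 + r) + v) powr (-s) = 3 powr (-s) * (of_nat n + (v + of_nat r) / 3) powr (-s)"
      by (simp only:) (rule powr_times_real_left, auto)
    moreover have "z ^ (n * 3 + r) = z ^ r * (z ^ 3) ^ n"
      by (simp add: power_add power_mult[symmetric] mult.commute)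
    ultimately show ?thesis unfolding f_def lerch_term_eq by (simp only: mult_ac)
  qed
  have "f sums lerch_phi z s v" unfolding f_def by (rule lerch_phi_sums[OF z])
  from sums_group[OF this, of 3]
  have "(\<lambda>n. f (n * 3 + 0) + f (n * 3 + 1) + f (n * 3 + 2)) sums lerch_phi z s v"
    by (simp add: numeral_3_eq_3 add.assoc)
  moreover have "(\<lambda>n. f (n * 3 + 0) + f (n * 3 + 1) + f (n * 3 + 2)) sums
      (3 powr (-s) * (z ^ 0 * lerch_phi (z ^ 3) s ((v + of_nat 0) / 3)) +
       3 powr (-s) * (z ^ 1 * lerch_phi (z ^ 3) s ((v + of_nat 1) / 3)) +
       3 powr (-s) * (z ^ 2 * lerch_phi (z ^ 3) s ((v + of_nat 2) / 3)))"
    unfolding f_eq by (intro sums_add sums_mult lerch_phi_sums z3)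
  ultimately show ?thesis
    by (subst sums_unique2) (auto simp: ring_distribs)
qed

lemma cube_in_lerch_cut:
  assumes "z \<in> lerch_cut" shows "z ^ 3 \<in> lerch_cut"
proof -
  obtain x where x: "z = of_real x" "x \<ge> 1" using assms by (auto simp: lerch_cut_def)
  have "z ^ 3 = of_real (x ^ 3)" "x ^ 3 \<ge> 1" using x by (auto simp: one_le_power)
  thus ?thesis unfolding lerch_cut_def by (intro image_eqI[of _ _ "x ^ 3"]) auto
qed

text \<open>
  Continuation in \<open>z\<close>. The preimage of the cut plane under cubing is star-shaped
  about 0, because \<open>r z\<close> has the cube \<open>r^3 z^3\<close>.
\<close>
lemma lerch_phi_trisection_off_cut:
  assumes z: "z ^ 3 \<notin> lerch_cut"
  shows "lerch_phi z s v = 3 powr (-s) * (lerch_phi (z ^ 3) s (v / 3) +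
           z * lerch_phi (z ^ 3) s ((v + 1) / 3) + z\<^sup>2 * lerch_phi (z ^ 3) s ((v + 2) / 3))"
proof -
  define S where "S = (\<lambda>z::complex. z ^ 3) -` (- lerch_cut)"
  define R where "R = (\<lambda>z. 3 powr (-s) * (lerch_phi (z ^ 3) s (v / 3) +
           z * lerch_phi (z ^ 3) s ((v + 1) / 3) + z\<^sup>2 * lerch_phi (z ^ 3) s ((v + 2) / 3)))"
  have cube: "(\<lambda>z. lerch_phi (z ^ 3) s u) holomorphic_on S" for u
  proof -
    have "(\<lambda>z. lerch_phi z s u) \<circ> (\<lambda>z. z ^ 3) holomorphic_on S"
      by (intro holomorphic_on_compose_gen[OF _ lerch_phi_holomorphic_z] holomorphic_intros)
         (auto simp: S_def)
    thus ?thesis by (simp add: o_def)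
  qed
  have "lerch_phi z s v = R z"
  proof (rule analytic_continuation_open[of "ball 0 1" S "\<lambda>z. lerch_phi z s v" R])
    show "open S"
      unfolding S_def by (intro open_vimage open_Compl_lerch_cut continuous_intros)
    show "connected S"
    proof (rule starlike_imp_connected)
      have "closed_segment 0 z \<subseteq> S" if z: "z \<in> S" for z
      proof
        fix x assume "x \<in> closed_segment 0 z"
        then obtain r where r: "0 \<le> r" "r \<le> 1" "x = of_real r * z"
          by (auto simp: in_segment scaleR_conv_of_real)
        have "of_real (r ^ 3) * z ^ 3 \<notin> lerch_cut"
          using z r by (intro scale_notin_lerch_cut) (auto simp: S_def power_le_one)
        thus "x \<in> S" by (simp add: S_def r power_mult_distrib)
      qed
      thus "starlike S"
        unfolding starlike_def by (intro bexI[of _ 0]) (auto simp: S_def lerch_cut_iff)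
    qed
    show "ball 0 1 \<subseteq> S"
    proof
      fix x :: complex assume "x \<in> ball 0 1"
      hence "x ^ 3 \<in> ball 0 1" using power_strict_mono[of "norm x" 1 3] by (simp add: norm_power)
      thus "x \<in> S" using ball_subset_Compl_lerch_cut by (auto simp: S_def)
    qed
    show "(\<lambda>z. lerch_phi z s v) holomorphic_on S"
      by (rule holomorphic_on_subset[OF lerch_phi_holomorphic_z])
         (use cube_in_lerch_cut in \<open>auto simp: S_def\<close>)
    show "R holomorphic_on S"
      unfolding R_def by (intro holomorphic_intros cube)
    show "lerch_phi x s v = R x" if "x \<in> ball 0 1" for x
      unfolding R_def using that by (intro lerch_phi_trisection_series) simp
  qed (use z in \<open>auto simp: S_def\<close>)
  thus ?thesis by (simp add: R_def)
qed

text \<open>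
  Continuation in \<open>s\<close> from the half-plane of convergence. Punctured at the pole,
  the plane remains connected. For \<open>z \<noteq> 1\<close> the left-hand side is entire in
  \<open>s\<close>.
\<close>
lemma lerch_phi_trisection_at_cube_roots:
  assumes z: "z ^ 3 = 1" and s: "s \<noteq> 1"
  shows "lerch_phi z s v = 3 powr (-s) * (lerch_phi (z ^ 3) s (v / 3) +
           z * lerch_phi (z ^ 3) s ((v + 1) / 3) + z\<^sup>2 * lerch_phi (z ^ 3) s ((v + 2) / 3))"
proof (rule analytic_continuation_open[of "{s. Re s > 1}" "- {1}" "\<lambda>s. lerch_phi z s v"
         "\<lambda>s. 3 powr (-s) * (lerch_phi (z ^ 3) s (v / 3) +
           z * lerch_phi (z ^ 3) s ((v + 1) / 3) + z\<^sup>2 * lerch_phi (z ^ 3) s ((v + 2) / 3))"])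
  have nz: "norm z = 1"
    using z power_eq_1_iff[of z 3] by auto
  show "connected (- {1 :: complex})" by (rule connected_punctured_universe) simp
  show "{s::complex. 1 < Re s} \<noteq> {}" by (auto intro: exI[of _ 2])
  show "(\<lambda>s. lerch_phi z s v) holomorphic_on - {1}"
  proof (cases "z = 1")
    case True
    thus ?thesis using lerch_phi_1_holomorphic_s by simp
  next
    case False
    have "z \<notin> lerch_cut"
    proof
      assume "z \<in> lerch_cut"
      then obtain x where "z = of_real x" "x \<ge> 1" by (auto simp: lerch_cut_def)
      with nz False show False by simp
    qed
    thus ?thesis using lerch_phi_holomorphic_s holomorphic_on_subset by blast
  qed
  show "(\<lambda>s. 3 powr (-s) * (lerch_phi (z ^ 3) s (v / 3) +
           z * lerch_phi (z ^ 3) s ((v + 1) / 3) + z\<^sup>2 * lerch_phi (z ^ 3) s ((v + 2) / 3))) holomorphic_on - {1}"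
    unfolding z by (intro holomorphic_intros lerch_phi_1_holomorphic_s)
  show "lerch_phi z s v = 3 powr (-s) * (lerch_phi (z ^ 3) s (v / 3) +
           z * lerch_phi (z ^ 3) s ((v + 1) / 3) + z\<^sup>2 * lerch_phi (z ^ 3) s ((v + 2) / 3))"
    if "s \<in> {s. Re s > 1}" for s
    using that nz by (intro lerch_phi_trisection_series) simp
qed (use s in \<open>auto simp: open_halfspace_Re_gt\<close>)

lemma lerch_phi_trisection:
  assumes "z ^ 3 \<notin> lerch_cut \<or> z ^ 3 = 1 \<and> s \<noteq> 1"
  shows "lerch_phi z s v = 3 powr (-s) * (lerch_phi (z ^ 3) s (v / 3) +
           z * lerch_phi (z ^ 3) s ((v + 1) / 3) + z\<^sup>2 * lerch_phi (z ^ 3) s ((v + 2) / 3))"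
  using assms lerch_phi_trisection_off_cut lerch_phi_trisection_at_cube_roots by blast

section \<open>The telescoping sum\<close>

theorem theorem4p143:
  fixes n :: nat and k m a :: complex
  assumes "n \<ge> 1" and "a \<noteq> 0"
    and "\<And>p. p \<in> {1..n} \<Longrightarrow>
           lerch_phi_defined (exp (2 * \<i> * 3 ^ p * m)) (- k) (1/3 - 1/2 * \<i> * Ln a / 3 ^ p)"
    and "\<And>p. p \<in> {1..n} \<Longrightarrow>
           lerch_phi_defined (exp (2 * \<i> * 3 ^ p * m)) (- k) (2/3 - 1/2 * \<i> * Ln a / 3 ^ p)"
    and "lerch_phi_defined (exp (2 * \<i> * m)) (- k) (1 - 1/2 * \<i> * Ln a)"
    and "lerch_phi_defined (exp (2 * \<i> * 3 ^ n * m)) (- k) (1 - 1/2 * \<i> * Ln a / 3 ^ n)"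
  shows
    "- (\<Sum>p = 1..n. (\<i> * 3 ^ p) powr k * exp (2 * \<i> * 3 ^ (p - 1) * m) *
          (lerch_phi (exp (2 * \<i> * 3 ^ p * m)) (- k) (1/3 - 1/2 * \<i> * Ln a / 3 ^ p)
           + exp (2 * \<i> * 3 ^ (p - 1) * m) *
             lerch_phi (exp (2 * \<i> * 3 ^ p * m)) (- k) (2/3 - 1/2 * \<i> * Ln a / 3 ^ p)))
     = - (\<i> powr k) * exp (2 * \<i> * m) *
          lerch_phi (exp (2 * \<i> * m)) (- k) (1 - 1/2 * \<i> * Ln a)
       + (\<i> * 3 ^ n) powr k * exp (2 * \<i> * 3 ^ n * m) *
          lerch_phi (exp (2 * \<i> * 3 ^ n * m)) (- k) (1 - 1/2 * \<i> * Ln a / 3 ^ n)"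
proof -
  define z where "z = (\<lambda>p::nat. exp (2 * \<i> * 3 ^ p * m))"
  define w where "w = (\<lambda>p::nat. 1/2 * \<i> * Ln a / 3 ^ p)"
  define T where "T = (\<lambda>p. (\<i> * 3 ^ p) powr k * z p * lerch_phi (z p) (- k) (1 - w p))"
  have cube: "z (Suc p) = z p ^ 3" for p
    by (simp add: z_def exp_of_nat_mult[symmetric] mult_ac)
  have step: "(\<i> * 3 ^ Suc p) powr k * z p *
                (lerch_phi (z (Suc p)) (- k) (1/3 - w (Suc p)) +
                 z p * lerch_phi (z (Suc p)) (- k) (2/3 - w (Suc p))) = T p - T (Suc p)"
    if p: "Suc p \<in> {1..n}" for p
  proof -
    have "z (Suc p) \<notin> lerch_cut \<or> z (Suc p) = 1 \<and> - k \<noteq> 1"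
      using assms(3)[OF p] unfolding lerch_phi_defined_def z_def by blast
    hence "z p ^ 3 \<notin> lerch_cut \<or> z p ^ 3 = 1 \<and> - k \<noteq> 1"
      unfolding cube .
    note tri = lerch_phi_trisection[OF this, of "1 - w p", folded cube]
    have v: "(1 - w p) / 3 = 1/3 - w (Suc p)" "(1 - w p + 1) / 3 = 2/3 - w (Suc p)"
            "(1 - w p + 2) / 3 = 1 - w (Suc p)"
      by (simp_all add: w_def field_simps)
    have pw: "(\<i> * 3 ^ Suc p) powr k = 3 powr k * (\<i> * 3 ^ p) powr k"
      using powr_times_real_left[of 3 "\<i> * 3 ^ p" k] by (simp add: mult_ac)
    show ?thesis
      unfolding T_def tri v pw cube minus_minus
      by (simp add: algebra_simps power2_eq_square power3_eq_cube)
  qed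
  have "(\<Sum>p = 1..n. (\<i> * 3 ^ p) powr k * z (p - 1) *
          (lerch_phi (z p) (- k) (1/3 - w p) + z (p - 1) * lerch_phi (z p) (- k) (2/3 - w p)))
        = (\<Sum>p = 1..n. T (p - 1) - T p)"
  proof (rule sum.cong[OF refl])
    fix p assume p: "p \<in> {1..n}"
    then obtain q where "p = Suc q" by (cases p) auto
    thus "(\<i> * 3 ^ p) powr k * z (p - 1) *
          (lerch_phi (z p) (- k) (1/3 - w p) + z (p - 1) * lerch_phi (z p) (- k) (2/3 - w p)) =
          T (p - 1) - T p"
      using step[of q] p by simp
  qed
  also have "\<dots> = T 0 - T n"
    by (induction n) auto
  finally show ?thesis
    by (simp add: T_def z_def w_def)
qed

end
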